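(* Let $\mathcal{N}_{A\to B}$ be a quantum channel (CPTP map), let $\varepsilon,\delta\in(0,1)$, and let $A'$ be a register with $A'\equiv A$. Suppose there is a pure state $\psi_{AA'}$ such that $R$ (with $2^R$ a positive integer) satisfies $$R\le \mathrm{D}^{\varepsilon}_{\mathrm{H}}\Big((\mathcal{N}_{A\to B}\otimes\mathrm{id}_{A'})(\psi_{AA'})\,\Big\|\,\mathcal{N}_{A\to B}(\psi_A)\otimes\psi_{A'}\Big)-2\log\frac{1}{\delta}.$$ Then there exists an $(R,2\varepsilon+2\delta)$-entanglement-assisted code for $\mathcal{N}_{A\to B}$.
   Context: All logarithms are base 2. For a state $\rho$ and positive semidefinite $\sigma$ on the same space, the smooth hypothesis-testing (min-)relative entropy is $\mathrm{D}^{\varepsilon}_{\mathrm{H}}(\rho\|\sigma)=\sup\{\log\frac{1}{\mathrm{Tr}(\Pi\sigma)}: 0\le\Pi\le I,\ \mathrm{Tr}(\Pi\rho)\ge 1-\varepsilon^2\}$. Marginals are denoted by dropping registers, e.g. $\psi_A=\mathrm{Tr}_{A'}\psi_{AA'}$. An $(R,\varepsilon)$-entanglement-assisted code for $\mathcal{N}_{A\to B}$ consists of: a pure state $\theta_{E_AE_B}$ shared by Alice (holding $E_A$) and Bob (holding $E_B$); for each message $m\in\{1,\dots,2^R\}$ an encoding quantum operation of Alice mapping $E_A$ to the channel input $A$; and a decoding POVM of Bob on $BE_B$ with outcomes in $\{1,\dots,2^R\}$ (output register $M'$), such that for every $m$, $\Pr(M'\neq m\mid M=m)\le\varepsilon^2$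 when Alice encodes $m$, sends $A$ through $\mathcal{N}$, and Bob measures $BE_B$. *)

theory Defs
  imports Jordan_Normal_Form.Matrix "HOL-Library.Extended_Real"
begin

text \<open>Finite-dimensional quantum information over complex matrices.
 Composite systems X Y of dimensions dX, dY are represented on dX*dY with
 index (x,y) encoded as x*dY + y (first factor = most significant).\<close>

type_synonym cmat = "complex mat"

definition mtrace :: "cmat \<Rightarrow> complex" where
  "mtrace A = (\<Sum>i<dim_row A. A $$ (i,i))"

definition psd :: "nat \<Rightarrow> cmat \<Rightarrow> bool" where
  "psd n A \<longleftrightarrow> A \<in> carrier_mat n n \<and>
     (\<forall>v \<in> carrier_vec n. let q = (\<Sum>i<n. cnj (v $ i) * (\<Sum>j<n. A $$ (i,j) * v $ j))
                            in Im q = 0 \<and> Re q \<ge> 0)"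

definition density :: "nat \<Rightarrow> cmat \<Rightarrow> bool" where
  "density n \<rho> \<longleftrightarrow> psd n \<rho> \<and> mtrace \<rho> = 1"

definition pure_state :: "nat \<Rightarrow> cmat \<Rightarrow> bool" where
  "pure_state n \<rho> \<longleftrightarrow> (\<exists>v \<in> carrier_vec n. (\<Sum>i<n. (cmod (v $ i))^2) = 1 \<and>
       \<rho> = mat n n (\<lambda>(i,j). v $ i * cnj (v $ j)))"

definition kron :: "cmat \<Rightarrow> cmat \<Rightarrow> cmat" where
  "kron A B = mat (dim_row A * dim_row B) (dim_col A * dim_col B)
     (\<lambda>(i,j). A $$ (i div dim_row B, j div dim_col B) * B $$ (i mod dim_row B, j mod dim_col B))"

definition ptrace2 :: "nat \<Rightarrow> nat \<Rightarrow> cmat \<Rightarrow> cmat" where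
  "ptrace2 dX dY M = mat dX dX (\<lambda>(i,j). \<Sum>k<dY. M $$ (i*dY + k, j*dY + k))"

definition ptrace1 :: "nat \<Rightarrow> nat \<Rightarrow> cmat \<Rightarrow> cmat" where
  "ptrace1 dX dY M = mat dY dY (\<lambda>(i,j). \<Sum>k<dX. M $$ (k*dY + i, k*dY + j))"

definition tensor_id :: "(cmat \<Rightarrow> cmat) \<Rightarrow> nat \<Rightarrow> nat \<Rightarrow> nat \<Rightarrow> cmat \<Rightarrow> cmat" where
  "tensor_id N dA dB k X = mat (dB*k) (dB*k) (\<lambda>(p,q).
      N (mat dA dA (\<lambda>(i,j). X $$ (i*k + p mod k, j*k + q mod k))) $$ (p div k, q div k))"

definition channel :: "nat \<Rightarrow> nat \<Rightarrow> (cmat \<Rightarrow> cmat) \<Rightarrow> bool" where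
  "channel dA dB N \<longleftrightarrow>
     (\<forall>X \<in> carrier_mat dA dA. N X \<in> carrier_mat dB dB) \<and>
     (\<forall>X \<in> carrier_mat dA dA. \<forall>Y \<in> carrier_mat dA dA. \<forall>c::complex.
         N (c \<cdot>\<^sub>m X + Y) = c \<cdot>\<^sub>m N X + N Y) \<and>
     (\<forall>X \<in> carrier_mat dA dA. mtrace (N X) = mtrace X) \<and>
     (\<forall>k. \<forall>X. psd (dA*k) X \<longrightarrow> psd (dB*k) (tensor_id N dA dB k X))"

text \<open>Smooth hypothesis-testing relative entropy (log base 2), valued in ereal;
 a test with Tr(P\<sigma>) = 0 contributes +\<infinity> (= log(1/0)).\<close>
definition DH :: "real \<Rightarrow> nat \<Rightarrow> cmat \<Rightarrow> cmat \<Rightarrow> ereal" where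
  "DH \<epsilon> n \<rho> \<sigma> = Sup {(if Re (mtrace (P * \<sigma>)) = 0 then \<infinity>
                          else ereal (log 2 (1 / Re (mtrace (P * \<sigma>))))) | P.
       psd n P \<and> psd n (1\<^sub>m n - P) \<and> Re (mtrace (P * \<rho>)) \<ge> 1 - \<epsilon>^2}"

definition povm :: "nat \<Rightarrow> nat \<Rightarrow> (nat \<Rightarrow> cmat) \<Rightarrow> bool" where
  "povm n M \<Lambda> \<longleftrightarrow> (\<forall>m<M. psd n (\<Lambda> m)) \<and> (\<forall>i<n. \<forall>j<n. (\<Sum>m<M. \<Lambda> m $$ (i,j)) = (1\<^sub>m n :: cmat) $$ (i,j))"

text \<open>(R,e)-entanglement-assisted code with M = 2^R messages (indexed 0..M-1).
 Shared pure state \<theta> on E_A E_B (dims dEA, dEB), encoders Enc m: E_A \<rightarrow> A (CPTP),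
 decoding POVM \<Lambda> on B E_B.\<close>
definition EA_code :: "nat \<Rightarrow> nat \<Rightarrow> (cmat \<Rightarrow> cmat) \<Rightarrow> nat \<Rightarrow> real \<Rightarrow> bool" where
  "EA_code dA dB N M e \<longleftrightarrow>
    (\<exists>dEA dEB \<theta> Enc \<Lambda>. dEA > 0 \<and> dEB > 0 \<and> pure_state (dEA*dEB) \<theta> \<and>
       (\<forall>m<M. channel dEA dA (Enc m)) \<and> povm (dB*dEB) M \<Lambda> \<and>
       (\<forall>m<M. let out = tensor_id N dA dB dEB (tensor_id (Enc m) dEA dA dEB \<theta>) in
           Re (\<Sum>m'\<in>{..<M} - {m}. mtrace (\<Lambda> m' * out)) \<le> e^2))"

end

theory Submission
  imports Defs Jordan_Normal_Form.Schur_Decomposition "HOL-Library.FuncSet"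
begin

text \<open>Position-based decoding: Alice and Bob share \<open>M\<close> copies of \<open>\<psi>\<close>, and Alice sends message \<open>m\<close>
  by transmitting her half of the \<open>m\<close>-th copy. With a near-optimal test \<open>T\<close> for the relative entropy,
  Bob's operator \<open>S\<^sub>m\<close> applies \<open>T\<close> to the channel output and his \<open>m\<close>-th register; it accepts message
  \<open>m\<close> with probability at least \<open>1 - \<epsilon>\<^sup>2\<close> and every other message with probability \<open>t\<close>, where
  \<open>M t \<le> \<delta>\<^sup>2 + \<epsilon> \<delta>\<close>. The square-root measurement of the \<open>S\<^sub>m\<close> (regularised by \<open>\<eta> = \<epsilon> \<delta>\<close>, which
  makes their sum invertible) then has error at most \<open>2 \<epsilon>\<^sup>2 + 4 (M t + \<eta>) \<le> (2 \<epsilon> + 2 \<delta>)\<^sup>2\<close> by the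
  Hayashi--Nagaoka inequality.\<close>

section \<open>Hermitian forms\<close>

text \<open>The target \<open>(2 * \<epsilon> + 2 * \<delta>)\<^sup>2\<close> has the cross term
  \<open>8 * \<epsilon> * \<delta>\<close>, which pays for two slacks of size
  \<open>\<epsilon> * \<delta>\<close>, each weighted by 4: one because a supremum only provides
  tests that are optimal up to a factor (here \<open>1 + \<epsilon> / \<delta>\<close>), one for the
  regulariser. The weights 2 and 4 are the Hayashi--Nagaoka coefficients \<open>1 + c\<close> and
  \<open>2 + c + 1 / c\<close> at \<open>c = 1\<close>.

  An operator inequality is stated as an inequality of quadratic forms at every vector, so the
  measurement bound becomes real arithmetic at a fixed vector. States enter only at the end, when a
  positive operator is paired with one.

  On the tensor-power side every object is written entrywise as a product over the \<open>M\<close>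
  positions, Kronecker deltas included. For fixed channel indices, exchanging sum and product then
  factorises each acceptance probability over the copies, and a copy that is neither sent nor tested
  contributes a trace equal to 1.\<close>

definition cinner :: "nat \<Rightarrow> (nat \<Rightarrow> complex) \<Rightarrow> (nat \<Rightarrow> complex) \<Rightarrow> complex" where
  "cinner n x y = (\<Sum>i<n. cnj (x i) * y i)"

definition sqnorm :: "nat \<Rightarrow> (nat \<Rightarrow> complex) \<Rightarrow> real" where
  "sqnorm n x = (\<Sum>i<n. (cmod (x i))\<^sup>2)"

definition mat_app :: "nat \<Rightarrow> (nat \<Rightarrow> nat \<Rightarrow> complex) \<Rightarrow> (nat \<Rightarrow> complex) \<Rightarrow> nat \<Rightarrow> complex" where
  "mat_app n A x i = (\<Sum>j<n. A i j * x j)"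

definition hermitian :: "nat \<Rightarrow> (nat \<Rightarrow> nat \<Rightarrow> complex) \<Rightarrow> bool" where
  "hermitian n A \<longleftrightarrow> (\<forall>i<n. \<forall>j<n. A i j = cnj (A j i))"

definition qform :: "nat \<Rightarrow> (nat \<Rightarrow> nat \<Rightarrow> complex) \<Rightarrow> (nat \<Rightarrow> complex) \<Rightarrow> real" where
  "qform n A x = Re (cinner n x (mat_app n A x))"

text \<open>Vectors and matrices are total functions of which only the entries below
  \<open>n\<close> matter. Most identities hold only there, so they are transported by congruence
  instead of by rewriting.\<close>

lemma cinner_cong:
  assumes "\<And>i. i < n \<Longrightarrow> x i = x' i" "\<And>i. i < n \<Longrightarrow> y i = y' i"
  shows "cinner n x y = cinner n x' y'"
  unfolding cinner_def using assms by (intro sum.cong) auto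

lemma mat_app_cong:
  assumes "\<And>i j. i < n \<Longrightarrow> j < n \<Longrightarrow> A i j = A' i j" "\<And>i. i < n \<Longrightarrow> x i = x' i" "i < n"
  shows "mat_app n A x i = mat_app n A' x' i"
  unfolding mat_app_def using assms by (intro sum.cong) auto

lemma qform_cong:
  assumes "\<And>i j. i < n \<Longrightarrow> j < n \<Longrightarrow> A i j = A' i j" "\<And>i. i < n \<Longrightarrow> x i = x' i"
  shows "qform n A x = qform n A' x'"
  unfolding qform_def using assms by (intro arg_cong[where f = Re] cinner_cong mat_app_cong) auto

lemma cinner_add_right: "cinner n x (\<lambda>i. y i + z i) = cinner n x y + cinner n x z"
  by (simp add: cinner_def algebra_simps sum.distrib)

lemma cinner_diff_right: "cinner n x (\<lambda>i. y i - z i) = cinner n x y - cinner n x z"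
  by (simp add: cinner_def algebra_simps sum_subtractf)

lemma cinner_scale_right: "cinner n x (\<lambda>i. c * y i) = c * cinner n x y"
  by (simp add: cinner_def sum_distrib_left mult_ac)

lemma cinner_add_left: "cinner n (\<lambda>i. x i + y i) z = cinner n x z + cinner n y z"
  by (simp add: cinner_def algebra_simps sum.distrib)

lemma cinner_diff_left: "cinner n (\<lambda>i. x i - y i) z = cinner n x z - cinner n y z"
  by (simp add: cinner_def algebra_simps sum_subtractf)

lemma cinner_scale_left: "cinner n (\<lambda>i. c * x i) y = cnj c * cinner n x y"
  by (simp add: cinner_def sum_distrib_left mult_ac)

lemma cinner_commute: "cinner n y x = cnj (cinner n x y)"
  by (simp add: cinner_def mult_ac)

lemma cinner_self: "cinner n x x = complex_of_real (sqnorm n x)"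
  unfolding cinner_def sqnorm_def of_real_sum
  by (intro sum.cong refl) (simp only: complex_norm_square mult.commute)

lemma sqnorm_nonneg: "0 \<le> sqnorm n x"
  by (simp add: sqnorm_def sum_nonneg)

lemma sqnorm_eq_0: "sqnorm n x = 0 \<longleftrightarrow> (\<forall>i<n. x i = 0)"
  by (auto simp: sqnorm_def sum_nonneg_eq_0_iff)

lemma mat_app_add: "mat_app n A (\<lambda>i. x i + y i) = (\<lambda>i. mat_app n A x i + mat_app n A y i)"
  by (simp add: fun_eq_iff mat_app_def algebra_simps sum.distrib)

lemma mat_app_diff: "mat_app n A (\<lambda>i. x i - y i) = (\<lambda>i. mat_app n A x i - mat_app n A y i)"
  by (simp add: fun_eq_iff mat_app_def algebra_simps sum_subtractf)

lemma mat_app_scale: "mat_app n A (\<lambda>i. c * x i) = (\<lambda>i. c * mat_app n A x i)"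
  by (simp add: fun_eq_iff mat_app_def sum_distrib_left mult_ac)

lemma mat_app_diff_mat: "mat_app n (\<lambda>i j. A i j - B i j) x = (\<lambda>i. mat_app n A x i - mat_app n B x i)"
  by (simp add: fun_eq_iff mat_app_def algebra_simps sum_subtractf)

lemma hermitianD: "hermitian n A \<Longrightarrow> i < n \<Longrightarrow> j < n \<Longrightarrow> cnj (A j i) = A i j"
  unfolding hermitian_def by metis

lemma hermitian_cinner:
  assumes "hermitian n A"
  shows "cinner n x (mat_app n A y) = cinner n (mat_app n A x) y"
proof -
  have "cinner n x (mat_app n A y) = (\<Sum>i<n. \<Sum>j<n. cnj (x i) * A i j * y j)"
    by (simp add: cinner_def mat_app_def sum_distrib_left mult_ac)
  also have "\<dots> = (\<Sum>j<n. \<Sum>i<n. cnj (x i) * A i j * y j)"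
    by (rule sum.swap)
  also have "\<dots> = (\<Sum>j<n. \<Sum>i<n. cnj (x i) * cnj (A j i) * y j)"
    using hermitianD[OF assms] by (intro sum.cong) auto
  also have "\<dots> = cinner n (mat_app n A x) y"
    by (simp add: cinner_def mat_app_def sum_distrib_right sum_distrib_left mult_ac)
  finally show ?thesis .
qed

lemma hermitian_qform:
  assumes "hermitian n A"
  shows "cinner n x (mat_app n A x) = complex_of_real (qform n A x)"
proof -
  have "cnj (cinner n x (mat_app n A x)) = cinner n x (mat_app n A x)"
    using hermitian_cinner[OF assms, of x x] cinner_commute by metis
  then have "Im (cinner n x (mat_app n A x)) = 0"
    by (metis complex_cnj_cancel_iff complex_In_mult_cnj_zero cnj.simps(2) equal_neg_zero)
  then show ?thesis by (simp add: qform_def complex_eq_iff)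
qed

lemma cinner_delta: 
  assumes "i < n" shows "cinner n (\<lambda>k. of_bool (k = i)) y = y i"
proof -
  have "cinner n (\<lambda>k. of_bool (k = i)) y = (\<Sum>k<n. if k = i then y k else 0)"
    unfolding cinner_def by (intro sum.cong) auto
  then show ?thesis using assms by (simp add: sum.delta)
qed

lemma mat_app_delta:
  assumes "i < n" shows "mat_app n A (\<lambda>k. of_bool (k = i)) j = A j i"
proof -
  have "mat_app n A (\<lambda>k. of_bool (k = i)) j = (\<Sum>k<n. if k = i then A j k else 0)"
    unfolding mat_app_def by (intro sum.cong) auto
  then show ?thesis using assms by (simp add: sum.delta)
qed

text \<open>Polarisation: the form at \<open>e_i + e_j\<close> gives equality of the imaginary parts
  up to sign, the form at \<open>e_i + \<i> e_j\<close> equality of the real parts.\<close>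

lemma hermitian_if_real_form:
  assumes real: "\<And>x. Im (cinner n x (mat_app n A x)) = 0"
  shows "hermitian n A"
  unfolding hermitian_def
proof (intro allI impI)
  fix i j assume ij: "i < n" "j < n"
  let ?x = "\<lambda>k. of_bool (k = i) :: complex" and ?y = "\<lambda>k. of_bool (k = j) :: complex"
  have 1: "cinner n ?x (mat_app n A ?y) = A i j" "cinner n ?y (mat_app n A ?x) = A j i"
    using ij by (simp_all add: cinner_delta mat_app_delta)
  have "Im (A i j + A j i) = 0"
    using real[of "\<lambda>k. ?x k + ?y k"] real[of ?x] real[of ?y] 1
    by (simp only: mat_app_add cinner_add_left cinner_add_right plus_complex.sel)
  moreover have "Im (\<i> * A i j - \<i> * A j i) = 0"
    using real[of "\<lambda>k. ?x k + \<i> * ?y k"] real[of ?x] real[of ?y] 1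
    by (simp add: mat_app_add cinner_add_left cinner_add_right mat_app_scale
        cinner_scale_left cinner_scale_right)
  ultimately show "A i j = cnj (A j i)"
    by (simp add: complex_eq_iff)
qed

text \<open>Over the complex numbers a real-valued form is the same as a Hermitian matrix, so the
  definition of \<open>psd\<close> splits into Hermiticity and nonnegativity of a real form.\<close>

lemma psd_iff_qform:
  "psd n A \<longleftrightarrow> A \<in> carrier_mat n n \<and> hermitian n (\<lambda>i j. A $$ (i,j)) \<and>
     (\<forall>x. 0 \<le> qform n (\<lambda>i j. A $$ (i,j)) x)"
proof -
  let ?A = "\<lambda>i j. A $$ (i,j)"
  let ?q = "\<lambda>x. cinner n x (mat_app n ?A x)"
  have "(\<forall>v \<in> carrier_vec n. let q = (\<Sum>i<n. cnj (v $ i) * (\<Sum>j<n. A $$ (i,j) * v $ j))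
                            in Im q = 0 \<and> Re q \<ge> 0) \<longleftrightarrow> (\<forall>x. Im (?q x) = 0 \<and> Re (?q x) \<ge> 0)"
    (is "?L \<longleftrightarrow> ?R")
  proof
    assume L: ?L
    show ?R
    proof
      fix x
      have "(\<Sum>i<n. cnj (vec n x $ i) * (\<Sum>j<n. A $$ (i,j) * vec n x $ j)) = ?q x"
        by (simp add: cinner_def mat_app_def)
      then show "Im (?q x) = 0 \<and> Re (?q x) \<ge> 0"
        using L[rule_format, of "vec n x"] by (simp add: Let_def)
    qed
  next
    assume ?R
    then show ?L by (auto simp: Let_def cinner_def mat_app_def)
  qed
  then have psd: "psd n A \<longleftrightarrow> A \<in> carrier_mat n n \<and> (\<forall>x. Im (?q x) = 0 \<and> 0 \<le> Re (?q x))"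
    unfolding psd_def by simp
  have "Im (?q x) = 0" if "hermitian n ?A" for x
    unfolding hermitian_qform[OF that] by simp
  then show ?thesis
    unfolding psd qform_def using hermitian_if_real_form[of n ?A] by blast
qed

lemma mtrace_mult:
  assumes "A \<in> carrier_mat n m" "B \<in> carrier_mat m n"
  shows "mtrace (A * B) = (\<Sum>i<n. \<Sum>j<m. A $$ (i,j) * B $$ (j,i))"
  using assms by (auto simp: mtrace_def scalar_prod_def lessThan_atLeast0 intro!: sum.cong)

lemma mtrace_mult_commute:
  assumes "A \<in> carrier_mat n m" "B \<in> carrier_mat m n"
  shows "mtrace (A * B) = mtrace (B * A)"
  unfolding mtrace_mult[OF assms] mtrace_mult[OF assms(2,1)]
  by (subst sum.swap) (simp add: mult.commute)

text \<open>If all eigenvalues vanish, a Schur form is strictly upper triangular, so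
  \<open>A\<^sup>2\<close> has trace zero; but this trace is the squared Frobenius norm.\<close>
lemma hermitian_nonzero_eigenvector:
  assumes herm: "hermitian n A" and nz: "\<exists>i<n. \<exists>j<n. A i j \<noteq> 0"
  obtains \<mu> v where "\<mu> \<noteq> 0" "sqnorm n v = 1"
    "\<And>i. i < n \<Longrightarrow> mat_app n A v i = complex_of_real \<mu> * v i"
proof -
  define A' where "A' = mat n n (\<lambda>(i,j). A i j)"
  have A': "A' \<in> carrier_mat n n" by (simp add: A'_def)
  obtain as where as: "char_poly A' = (\<Prod>a\<leftarrow>as. [:- a, 1:])"
    using char_poly_factorized[OF A'] by auto
  obtain B P Q where schur: "schur_decomposition A' as = (B, P, Q)"
    by (cases "schur_decomposition A' as") auto
  have sim: "similar_mat_wit A' B P Q" and tri: "upper_triangular B" and diag: "diag_mat B = as"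
    using schur_decomposition[OF A' as schur] by auto
  have B: "B \<in> carrier_mat n n" and P: "P \<in> carrier_mat n n" and Q: "Q \<in> carrier_mat n n"
    and QP: "Q * P = 1\<^sub>m n" and A'B: "A' = P * B * Q"
    using similar_mat_witD2[OF A' sim] by auto
  have "\<exists>a\<in>set as. a \<noteq> 0"
  proof (rule ccontr)
    assume zero: "\<not> (\<exists>a\<in>set as. a \<noteq> 0)"
    have B0: "B $$ (i,j) = 0" if "i < n" "j \<le> i" for i j
    proof (cases "j = i")
      case True
      have "B $$ (i,i) \<in> set as"
        unfolding diag[symmetric] diag_mat_def using that B by auto
      then show ?thesis using zero True by auto
    next
      case False
      then show ?thesis using tri that B unfolding upper_triangular_def by auto
    qed
    have "A' * A' = P * (B * B * Q)"
    proof -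
      have "A' * A' = P * B * Q * (P * (B * Q))"
        unfolding A'B using P B Q by (simp add: assoc_mult_mat[of _ n n _ n _ n])
      also have "\<dots> = P * B * (Q * P * (B * Q))"
        using P B Q by (simp add: assoc_mult_mat[of _ n n _ n _ n])
      also have "\<dots> = P * (B * B * Q)"
        unfolding QP using P B Q by (simp add: assoc_mult_mat[of _ n n _ n _ n])
      finally show ?thesis .
    qed
    then have "mtrace (A' * A') = mtrace (B * B * Q * P)"
      using mtrace_mult_commute[of P n n "B * B * Q"] P B Q by auto
    also have "B * B * Q * P = B * B"
    proof -
      have "B * B * Q * P = B * B * (Q * P)"
        using P B Q by (intro assoc_mult_mat[of _ n n _ n _ n]) auto
      then show ?thesis unfolding QP using B by simp
    qed
    also have "mtrace (B * B) = 0"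
      unfolding mtrace_mult[OF B B]
    proof (intro sum.neutral ballI)
      fix i j assume "i \<in> {..<n}" "j \<in> {..<n}"
      then show "B $$ (i,j) * B $$ (j,i) = 0"
        using B0[of i j] B0[of j i] by (cases "j \<le> i") auto
    qed
    finally have "(\<Sum>i<n. \<Sum>j<n. A' $$ (i,j) * A' $$ (j,i)) = 0"
      unfolding mtrace_mult[OF A' A'] .
    also have "(\<Sum>i<n. \<Sum>j<n. A' $$ (i,j) * A' $$ (j,i)) =
        complex_of_real (\<Sum>i<n. \<Sum>j<n. (cmod (A i j))\<^sup>2)"
      unfolding of_real_sum
    proof (intro sum.cong refl)
      fix i j assume ij: "i \<in> {..<n}" "j \<in> {..<n}"
      then have "A j i = cnj (A i j)" using hermitianD[OF herm, of j i] by simp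
      then show "A' $$ (i,j) * A' $$ (j,i) = complex_of_real ((cmod (A i j))\<^sup>2)"
        using ij unfolding complex_norm_square by (simp add: A'_def)
    qed
    finally have "(\<Sum>i<n. \<Sum>j<n. (cmod (A i j))\<^sup>2) = 0"
      using of_real_eq_0_iff by blast
    then show False
      using nz by (auto simp: sum_nonneg_eq_0_iff sum_nonneg)
  qed
  then obtain a where a: "a \<in> set as" "a \<noteq> 0" by auto
  have "poly (char_poly A') a = 0"
    unfolding as poly_prod_list using a(1) by (auto simp: prod_list_zero_iff)
  then have "eigenvalue A' a" using eigenvalue_root_char_poly[OF A'] by simp
  then obtain w where w: "w \<in> carrier_vec n" "w \<noteq> 0\<^sub>v n" "A' *\<^sub>v w = a \<cdot>\<^sub>v w"
    unfolding eigenvalue_def eigenvector_def using A' by auto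
  define c where "c = sqnorm n (\<lambda>i. w $ i)"
  define v where "v = (\<lambda>i. complex_of_real (1 / sqrt c) * w $ i)"
  have "\<exists>i<n. w $ i \<noteq> 0"
    using w(1,2) by (metis carrier_vecD eq_vecI index_zero_vec)
  then have c: "c > 0"
    unfolding c_def using sqnorm_nonneg[of n "\<lambda>i. w $ i"] sqnorm_eq_0[of n "\<lambda>i. w $ i"]
    by (metis order_le_less)
  have v1: "sqnorm n v = 1"
  proof -
    have "complex_of_real (sqnorm n v) = 1"
      unfolding cinner_self[symmetric] v_def cinner_scale_left cinner_scale_right
      unfolding cinner_self c_def[symmetric] using c
      by (simp add: field_simps flip: of_real_mult)
    then show ?thesis by simp
  qed
  have eig: "mat_app n A v i = a * v i" if "i < n" for i
  proof -
    have "(A' *\<^sub>v w) $ i = a * w $ i" using w that by simp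
    then have "mat_app n A (\<lambda>i. w $ i) i = a * w $ i"
      using that w(1) by (simp add: A'_def mat_app_def scalar_prod_def lessThan_atLeast0)
    then show ?thesis unfolding v_def mat_app_scale by simp
  qed
  \<comment> \<open>The eigenvalue is the value of the form at a unit eigenvector, hence
    real.\<close>
  have "cinner n v (mat_app n A v) = a"
    using cinner_cong[of n v v "mat_app n A v" "\<lambda>i. a * v i"] eig
    by (simp add: cinner_scale_right cinner_self v1)
  then have "a = complex_of_real (qform n A v)" using hermitian_qform[OF herm] by metis
  then show ?thesis using that[of "qform n A v" v] a v1 eig by auto
qed

section \<open>Spectral theorem and square roots\<close>

lemma cinner_sum_right: "cinner n x (\<lambda>i. \<Sum>a\<in>K. c a * y a i) = (\<Sum>a\<in>K. c a * cinner n x (y a))"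
proof -
  have "cinner n x (\<lambda>i. \<Sum>a\<in>K. c a * y a i) = (\<Sum>i<n. \<Sum>a\<in>K. c a * (cnj (x i) * y a i))"
    by (simp add: cinner_def sum_distrib_left mult_ac)
  also have "\<dots> = (\<Sum>a\<in>K. \<Sum>i<n. c a * (cnj (x i) * y a i))"
    by (rule sum.swap)
  finally show ?thesis by (simp add: cinner_def sum_distrib_left)
qed

definition orthonormal :: "nat \<Rightarrow> nat \<Rightarrow> (nat \<Rightarrow> nat \<Rightarrow> complex) \<Rightarrow> bool" where
  "orthonormal n k v \<longleftrightarrow> (\<forall>a<k. \<forall>b<k. cinner n (v a) (v b) = of_bool (a = b))"

lemma orthonormal_coeff:
  assumes "orthonormal n k v" "b < k"
  shows "cinner n (v b) (\<lambda>i. \<Sum>a<k. c a * v a i) = c b"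
proof -
  have "cinner n (v b) (\<lambda>i. \<Sum>a<k. c a * v a i) = (\<Sum>a<k. if a = b then c a else 0)"
    unfolding cinner_sum_right using assms by (intro sum.cong) (auto simp: orthonormal_def)
  then show ?thesis using assms(2) by (simp add: sum.delta)
qed

text \<open>With \<open>p\<close> the projection of \<open>x\<close> onto the span, both
  \<open>\<langle>x, p\<rangle>\<close> and \<open>\<langle>p, p\<rangle>\<close> equal the
  left-hand side, which leaves the squared norm of \<open>x - p\<close> as the difference.\<close>

lemma bessel:
  assumes on: "orthonormal n k v"
  shows "(\<Sum>a<k. (cmod (cinner n (v a) x))\<^sup>2) \<le> sqnorm n x"
proof -
  define c where "c = (\<lambda>a. cinner n (v a) x)"
  define p where "p = (\<lambda>i. \<Sum>a<k. c a * v a i)"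
  define S where "S = (\<Sum>a<k. (cmod (c a))\<^sup>2)"
  have xp: "cinner n x p = complex_of_real S"
    unfolding p_def cinner_sum_right S_def of_real_sum complex_norm_square
    by (intro sum.cong refl) (metis c_def cinner_commute)
  have "cinner n p (v a) = cnj (c a)" if "a < k" for a
    using orthonormal_coeff[OF on that, of c] unfolding p_def[symmetric] by (metis cinner_commute)
  then have pp: "cinner n p p = complex_of_real S"
    unfolding p_def[abs_def] cinner_sum_right S_def of_real_sum complex_norm_square
    by (intro sum.cong refl) (auto simp: p_def)
  have "complex_of_real (sqnorm n (\<lambda>i. x i - p i)) = complex_of_real (sqnorm n x - S)"
    unfolding cinner_self[symmetric] cinner_diff_left cinner_diff_right
    using xp pp cinner_commute[of n p x] by (simp add: cinner_self)
  then have "sqnorm n (\<lambda>i. x i - p i) = sqnorm n x - S" by (simp only: of_real_eq_iff)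
  then show ?thesis
    using sqnorm_nonneg[of n "\<lambda>i. x i - p i"] unfolding S_def c_def by simp
qed

text \<open>Sum the squared entries of all vectors in two ways: by vectors they give
  \<open>k\<close>, and each coordinate contributes at most 1 by Bessel applied to a unit vector.
  This bound is what makes a maximal family of eigenvectors exist.\<close>

lemma orthonormal_card_le:
  assumes on: "orthonormal n k v"
  shows "k \<le> n"
proof -
  have "real k = (\<Sum>a<k. sqnorm n (v a))"
  proof -
    have "complex_of_real (sqnorm n (v a)) = 1" if "a < k" for a
      unfolding cinner_self[symmetric] using on that by (simp add: orthonormal_def)
    then show ?thesis by simp
  qed
  also have "\<dots> = (\<Sum>j<n. \<Sum>a<k. (cmod (v a j))\<^sup>2)"
    unfolding sqnorm_def by (rule sum.swap)
  also have "\<dots> \<le> (\<Sum>j<n. 1)"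
  proof (rule sum_mono)
    fix j assume "j \<in> {..<n}"
    then have j: "j < n" by simp
    let ?e = "\<lambda>k. of_bool (k = j) :: complex"
    have "cinner n (v a) ?e = cnj (v a j)" for a
      using cinner_delta[OF j, of "v a"] by (metis cinner_commute)
    moreover have "complex_of_real (sqnorm n ?e) = 1"
      unfolding cinner_self[symmetric] using j by (simp add: cinner_delta)
    ultimately show "(\<Sum>a<k. (cmod (v a j))\<^sup>2) \<le> 1"
      using bessel[OF on, of ?e] by simp
  qed
  finally show ?thesis by simp
qed

text \<open>The family may have fewer than \<open>n\<close> members, so directions orthogonal to it
  are sent to 0. Varying \<open>l\<close> with \<open>v\<close> fixed gives a functional calculus,
  in which composition multiplies the coefficients.\<close>

definition spectral_sum :: "nat \<Rightarrow> (nat \<Rightarrow> real) \<Rightarrow> (nat \<Rightarrow> nat \<Rightarrow> complex) \<Rightarrow> nat \<Rightarrow> nat \<Rightarrow> complex" where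
  "spectral_sum k l v i j = (\<Sum>a<k. complex_of_real (l a) * v a i * cnj (v a j))"

lemma hermitian_spectral_sum: "hermitian n (spectral_sum k l v)"
  by (simp add: hermitian_def spectral_sum_def mult_ac)

lemma mat_app_spectral_sum:
  "mat_app n (spectral_sum k l v) x = (\<lambda>i. \<Sum>a<k. (complex_of_real (l a) * cinner n (v a) x) * v a i)"
proof
  fix i
  have "mat_app n (spectral_sum k l v) x i =
      (\<Sum>j<n. \<Sum>a<k. complex_of_real (l a) * v a i * (cnj (v a j) * x j))"
    by (simp add: mat_app_def spectral_sum_def sum_distrib_left sum_distrib_right mult_ac)
  also have "\<dots> = (\<Sum>a<k. \<Sum>j<n. complex_of_real (l a) * v a i * (cnj (v a j) * x j))"
    by (rule sum.swap)
  also have "\<dots> = (\<Sum>a<k. (complex_of_real (l a) * cinner n (v a) x) * v a i)"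
    by (simp add: cinner_def sum_distrib_left sum_distrib_right mult_ac)
  finally show "mat_app n (spectral_sum k l v) x i = \<dots>" .
qed

lemma qform_spectral_sum:
  "qform n (spectral_sum k l v) x = (\<Sum>a<k. l a * (cmod (cinner n (v a) x))\<^sup>2)"
proof -
  have "cinner n x (mat_app n (spectral_sum k l v) x) =
      complex_of_real (\<Sum>a<k. l a * (cmod (cinner n (v a) x))\<^sup>2)"
    unfolding mat_app_spectral_sum cinner_sum_right of_real_sum of_real_mult complex_norm_square
    by (intro sum.cong refl) (metis cinner_commute mult.assoc)
  then show ?thesis by (simp add: qform_def)
qed

lemma mat_app_spectral_sum_comp:
  assumes "orthonormal n k v"
  shows "mat_app n (spectral_sum k f v) (mat_app n (spectral_sum k g v) x) =
    mat_app n (spectral_sum k (\<lambda>a. f a * g a) v) x"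
proof -
  have "cinner n (v a) (mat_app n (spectral_sum k g v) x) = complex_of_real (g a) * cinner n (v a) x"
    if "a < k" for a
    unfolding mat_app_spectral_sum using orthonormal_coeff[OF assms that] .
  then show ?thesis
    unfolding mat_app_spectral_sum[of _ _ f] mat_app_spectral_sum[of _ _ "\<lambda>a. f a * g a"]
    by (intro ext sum.cong) (auto simp: mult.assoc)
qed

text \<open>A maximal orthonormal family of eigenvectors with nonzero eigenvalues exhausts \<open>A\<close>: otherwise
  the Hermitian remainder has an eigenvector with nonzero eigenvalue, which is orthogonal to the family.\<close>
lemma hermitian_spectral:
  assumes herm: "hermitian n A"
  obtains k l v where "orthonormal n k v"
    "\<And>a. a < k \<Longrightarrow> l a = qform n A (v a)"
    "\<And>i j. i < n \<Longrightarrow> j < n \<Longrightarrow> A i j = spectral_sum k l v i j"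
proof -
  define fam where "fam = (\<lambda>k l v. orthonormal n k v \<and>
    (\<forall>a<k. \<forall>i<n. mat_app n A (v a) i = complex_of_real (l a) * v a i))"
  have "\<exists>l v. fam 0 l v" by (simp add: fam_def orthonormal_def)
  moreover have "\<forall>k. (\<exists>l v. fam k l v) \<longrightarrow> k \<le> n"
    using orthonormal_card_le by (auto simp: fam_def)
  ultimately obtain k where ex: "\<exists>l v. fam k l v" and max: "\<And>k'. \<exists>l v. fam k' l v \<Longrightarrow> k' \<le> k"
    using Nat.ex_has_greatest_nat[of "\<lambda>k. \<exists>l v. fam k l v" 0 n] by metis
  from ex obtain l v where fam: "fam k l v" by blast
  then have on: "orthonormal n k v"
    and eig: "\<And>a i. a < k \<Longrightarrow> i < n \<Longrightarrow> mat_app n A (v a) i = complex_of_real (l a) * v a i"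
    by (auto simp: fam_def)
  define B where "B = (\<lambda>i j. A i j - spectral_sum k l v i j)"
  have hermB: "hermitian n B"
    using herm hermitian_spectral_sum[of n k l v] unfolding hermitian_def B_def
    by (metis complex_cnj_diff)
  have Bv: "mat_app n B (v b) i = 0" if "b < k" "i < n" for b i
  proof -
    have "mat_app n (spectral_sum k l v) (v b) i =
        (\<Sum>a<k. if a = b then complex_of_real (l a) * v a i else 0)"
      unfolding mat_app_spectral_sum using on that by (intro sum.cong) (auto simp: orthonormal_def)
    then show ?thesis
      unfolding B_def mat_app_diff_mat using eig that by (simp add: sum.delta)
  qed
  have zero: "B i j = 0" if "i < n" "j < n" for i j
  proof (rule ccontr)
    assume "B i j \<noteq> 0"
    then have "\<exists>i<n. \<exists>j<n. B i j \<noteq> 0" using that by blast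
    then obtain \<mu> w where \<mu>: "\<mu> \<noteq> 0" and w: "sqnorm n w = 1"
      and Bw: "\<And>i. i < n \<Longrightarrow> mat_app n B w i = complex_of_real \<mu> * w i"
      using hermitian_nonzero_eigenvector[OF hermB] by metis
    have orth: "cinner n (v b) w = 0" if "b < k" for b
    proof -
      have "complex_of_real \<mu> * cinner n (v b) w = cinner n (v b) (mat_app n B w)"
        unfolding cinner_scale_right[symmetric] using Bw by (intro cinner_cong) auto
      also have "\<dots> = cinner n (mat_app n B (v b)) w" by (rule hermitian_cinner[OF hermB])
      also have "\<dots> = 0" using Bv[OF that] by (simp add: cinner_def)
      finally show ?thesis using \<mu> by simp
    qed
    \<comment> \<open>By orthogonality the subtracted part kills \<open>w\<close>, so
      \<open>w\<close> is an eigenvector of \<open>A\<close> itself and extends the family, against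
      maximality.\<close>
    have "mat_app n (spectral_sum k l v) w i = 0" for i
      unfolding mat_app_spectral_sum using orth by simp
    then have Aw: "mat_app n A w i = complex_of_real \<mu> * w i" if "i < n" for i
      using Bw[OF that] unfolding B_def mat_app_diff_mat by simp
    have orth': "cinner n w (v b) = 0" if "b < k" for b
      using orth[OF that] cinner_commute[of n w "v b"] by simp
    have "fam (Suc k) (l(k := \<mu>)) (v(k := w))"
      unfolding fam_def orthonormal_def
      using on orth orth' w eig Aw cinner_self[of n w]
      by (auto simp: less_Suc_eq orthonormal_def)
    then show False using max[of "Suc k"] by auto
  qed
  have "l a = qform n A (v a)" if "a < k" for a
  proof -
    have "cinner n (v a) (mat_app n A (v a)) = cinner n (v a) (\<lambda>i. complex_of_real (l a) * v a i)"
      using eig[OF that] by (intro cinner_cong) auto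
    also have "\<dots> = complex_of_real (l a)"
      unfolding cinner_scale_right using on that by (simp add: orthonormal_def)
    finally show ?thesis by (simp add: qform_def)
  qed
  then show ?thesis using that[of k v l] on zero unfolding B_def by auto
qed

text \<open>The form is a combination of squares weighted by the eigenvalues, so a negative value
  forces a negative eigenvalue.\<close>

lemma negative_eigenvector:
  assumes herm: "hermitian n A" and neg: "qform n A x < 0"
  obtains \<mu> v where "\<mu> < 0" "sqnorm n v = 1"
    "\<And>i. i < n \<Longrightarrow> mat_app n A v i = complex_of_real \<mu> * v i"
proof -
  obtain k l v where on: "orthonormal n k v"
    and A: "\<And>i j. i < n \<Longrightarrow> j < n \<Longrightarrow> A i j = spectral_sum k l v i j"
    using hermitian_spectral[OF herm] by metis
  have "qform n A x = (\<Sum>a<k. l a * (cmod (cinner n (v a) x))\<^sup>2)"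
    unfolding qform_spectral_sum[symmetric] using A by (intro qform_cong) auto
  then obtain b where b: "b < k" "l b < 0"
    using neg sum_nonneg[of "{..<k}" "\<lambda>a. l a * (cmod (cinner n (v a) x))\<^sup>2"]
    by (metis lessThan_iff linorder_not_le mult_nonneg_nonneg zero_le_power2)
  have "mat_app n A (v b) i = complex_of_real (l b) * v b i" if "i < n" for i
  proof -
    have "mat_app n A (v b) i = mat_app n (spectral_sum k l v) (v b) i"
      using A that by (intro mat_app_cong) auto
    also have "\<dots> = (\<Sum>a<k. if a = b then complex_of_real (l a) * v a i else 0)"
      unfolding mat_app_spectral_sum using on b by (intro sum.cong) (auto simp: orthonormal_def)
    finally show ?thesis using b by (simp add: sum.delta)
  qed
  moreover have "complex_of_real (sqnorm n (v b)) = 1"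
    unfolding cinner_self[symmetric] using on b by (simp add: orthonormal_def)
  ultimately show ?thesis using that[of "l b" "v b"] b by simp
qed

text \<open>Diagonalising \<open>A\<close> turns the trace into the sum of
  \<open>l a * qform n B (v a)\<close>, whose terms are nonnegative. This converts operator
  inequalities into inequalities between outcome probabilities.\<close>

lemma psd_trace_mult_nonneg:
  assumes A: "psd n A" and B: "psd n B"
  shows "0 \<le> Re (mtrace (A * B))"
proof -
  let ?A = "\<lambda>i j. A $$ (i,j)" and ?B = "\<lambda>i j. B $$ (i,j)"
  have hermA: "hermitian n ?A" and posA: "\<And>x. 0 \<le> qform n ?A x" and cA: "A \<in> carrier_mat n n"
    and posB: "\<And>x. 0 \<le> qform n ?B x" and cB: "B \<in> carrier_mat n n"
    using A B by (auto simp: psd_iff_qform)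
  obtain k l v where l: "\<And>a. a < k \<Longrightarrow> l a = qform n ?A (v a)"
    and dec: "\<And>i j. i < n \<Longrightarrow> j < n \<Longrightarrow> ?A i j = spectral_sum k l v i j"
    using hermitian_spectral[OF hermA] by metis
  have "mtrace (A * B) = (\<Sum>i<n. \<Sum>j<n. spectral_sum k l v i j * B $$ (j,i))"
    unfolding mtrace_mult[OF cA cB] using dec by (intro sum.cong) auto
  also have "\<dots> = (\<Sum>i<n. \<Sum>j<n. \<Sum>a<k. complex_of_real (l a) * (cnj (v a j) * (B $$ (j,i) * v a i)))"
    by (simp add: spectral_sum_def sum_distrib_left sum_distrib_right mult_ac)
  also have "\<dots> = (\<Sum>i<n. \<Sum>a<k. \<Sum>j<n. complex_of_real (l a) * (cnj (v a j) * (B $$ (j,i) * v a i)))"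
    by (intro sum.cong refl sum.swap)
  also have "\<dots> = (\<Sum>a<k. \<Sum>i<n. \<Sum>j<n. complex_of_real (l a) * (cnj (v a j) * (B $$ (j,i) * v a i)))"
    by (rule sum.swap)
  also have "\<dots> = (\<Sum>a<k. \<Sum>j<n. \<Sum>i<n. complex_of_real (l a) * (cnj (v a j) * (B $$ (j,i) * v a i)))"
    by (intro sum.cong refl sum.swap)
  also have "\<dots> = (\<Sum>a<k. complex_of_real (l a) * cinner n (v a) (mat_app n ?B (v a)))"
    by (simp add: cinner_def mat_app_def sum_distrib_left)
  finally have "Re (mtrace (A * B)) = (\<Sum>a<k. l a * qform n ?B (v a))"
    by (simp add: qform_def)
  then show ?thesis using l posA posB by (auto intro!: sum_nonneg)
qed

lemma positive_definite_sqrt: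
  assumes herm: "hermitian n A" and "\<eta> > 0" and pos: "\<And>x. \<eta> * sqnorm n x \<le> qform n A x"
  obtains Q P where "hermitian n Q" "hermitian n P" "\<And>x. 0 \<le> qform n Q x"
    "\<And>x i. i < n \<Longrightarrow> mat_app n Q (mat_app n Q x) i = mat_app n A x i"
    "\<And>x i. i < n \<Longrightarrow> mat_app n Q (mat_app n P x) i = x i"
proof -
  obtain k l v where on: "orthonormal n k v"
    and l: "\<And>a. a < k \<Longrightarrow> l a = qform n A (v a)"
    and A: "\<And>i j. i < n \<Longrightarrow> j < n \<Longrightarrow> A i j = spectral_sum k l v i j"
    using hermitian_spectral[OF herm] by metis
  have appA: "mat_app n A x i = mat_app n (spectral_sum k l v) x i" if "i < n" for x i
    using A that by (intro mat_app_cong) auto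
  have lpos: "0 < l a" if "a < k" for a
  proof -
    have "complex_of_real (sqnorm n (v a)) = 1"
      unfolding cinner_self[symmetric] using on that by (simp add: orthonormal_def)
    then show ?thesis using pos[of "v a"] l[OF that] \<open>\<eta> > 0\<close> by simp
  qed
  \<comment> \<open>The eigenvector family is a full basis: the part \<open>z\<close> of
    \<open>x\<close> orthogonal to it has form 0, which the lower bound by \<open>\<eta>\<close>
    allows only for \<open>z = 0\<close>. Without this \<open>P\<close> would invert
    \<open>Q\<close> only on the span of the family.\<close>
  have complete: "mat_app n (spectral_sum k (\<lambda>a. 1) v) x i = x i" if "i < n" for x i
  proof -
    define z where "z = (\<lambda>i. x i - mat_app n (spectral_sum k (\<lambda>a. 1) v) x i)"
    have "cinner n (v a) z = 0" if "a < k" for a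
      unfolding z_def cinner_diff_right mat_app_spectral_sum orthonormal_coeff[OF on that] by simp
    then have "qform n A z = 0"
      using qform_cong[of n A "spectral_sum k l v" z z] A by (simp add: qform_spectral_sum)
    then have "sqnorm n z = 0"
      using pos[of z] sqnorm_nonneg[of n z] \<open>\<eta> > 0\<close>
      by (metis mult_pos_pos order_le_less linorder_not_le)
    then show ?thesis using that by (simp add: sqnorm_eq_0 z_def)
  qed
  define Q where "Q = spectral_sum k (\<lambda>a. sqrt (l a)) v"
  define P where "P = spectral_sum k (\<lambda>a. 1 / sqrt (l a)) v"
  have cong: "mat_app n (spectral_sum k f v) x = mat_app n (spectral_sum k g v) x"
    if "\<And>a. a < k \<Longrightarrow> f a = g a" for f g x
    unfolding mat_app_spectral_sum using that by simp
  show ?thesis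
  proof
    show "hermitian n Q" "hermitian n P" by (simp_all add: Q_def P_def hermitian_spectral_sum)
    show "0 \<le> qform n Q x" for x
      unfolding Q_def qform_spectral_sum by (intro sum_nonneg mult_nonneg_nonneg) (auto dest: lpos)
    show "mat_app n Q (mat_app n Q x) i = mat_app n A x i" if "i < n" for x i
      unfolding Q_def mat_app_spectral_sum_comp[OF on] appA[OF that]
      by (subst cong[where g = l]) (auto dest: lpos)
    show "mat_app n Q (mat_app n P x) i = x i" if "i < n" for x i
      unfolding Q_def P_def mat_app_spectral_sum_comp[OF on]
      by (subst cong[where g = "\<lambda>a. 1"]) (use complete that in \<open>auto dest: lpos\<close>)
  qed
qed

section \<open>The Hayashi--Nagaoka measurement\<close>

text \<open>A common linear functional for both uses of a matrix:
  \<open>W i j = cnj (x i) * x j\<close> gives its quadratic form at \<open>x\<close>, and the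
  transpose of a state gives the trace against that state.\<close>

definition mat_pair :: "nat \<Rightarrow> (nat \<Rightarrow> nat \<Rightarrow> complex) \<Rightarrow> (nat \<Rightarrow> nat \<Rightarrow> complex) \<Rightarrow> complex" where
  "mat_pair n A W = (\<Sum>i<n. \<Sum>j<n. A i j * W i j)"

lemma mat_pair_add: "mat_pair n (\<lambda>i j. A i j + B i j) W = mat_pair n A W + mat_pair n B W"
  by (simp add: mat_pair_def algebra_simps sum.distrib)

lemma mat_pair_diff: "mat_pair n (\<lambda>i j. A i j - B i j) W = mat_pair n A W - mat_pair n B W"
  by (simp add: mat_pair_def algebra_simps sum_subtractf)

lemma mat_pair_scale: "mat_pair n (\<lambda>i j. c * A i j) W = c * mat_pair n A W"
  by (simp add: mat_pair_def sum_distrib_left mult_ac)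

lemma mat_pair_sum: "mat_pair n (\<lambda>i j. \<Sum>m\<in>K. A m i j) W = (\<Sum>m\<in>K. mat_pair n (A m) W)"
proof -
  have "mat_pair n (\<lambda>i j. \<Sum>m\<in>K. A m i j) W = (\<Sum>i<n. \<Sum>m\<in>K. \<Sum>j<n. A m i j * W i j)"
    unfolding mat_pair_def sum_distrib_right by (intro sum.cong refl sum.swap)
  then show ?thesis unfolding mat_pair_def by (subst (asm) sum.swap)
qed

lemma mat_pair_delta: "mat_pair n (\<lambda>i j. of_bool (i = j)) W = (\<Sum>i<n. W i i)"
proof -
  have "(\<Sum>j<n. of_bool (i = j) * W i j) = W i i" if "i < n" for i
  proof -
    have "(\<Sum>j<n. of_bool (i = j) * W i j) = (\<Sum>j<n. if i = j then W i j else 0)"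
      by (intro sum.cong) auto
    then show ?thesis using that by (simp add: sum.delta')
  qed
  then show ?thesis by (simp add: mat_pair_def)
qed

lemma mat_pair_cong:
  assumes "\<And>i j. i < n \<Longrightarrow> j < n \<Longrightarrow> A i j = B i j"
  shows "mat_pair n A W = mat_pair n B W"
  unfolding mat_pair_def using assms by (intro sum.cong) auto

lemma qform_eq_pair: "qform n A x = Re (mat_pair n A (\<lambda>i j. cnj (x i) * x j))"
  by (simp add: qform_def cinner_def mat_app_def mat_pair_def sum_distrib_left mult_ac)

lemma mtrace_eq_pair:
  assumes "A \<in> carrier_mat n n" "B \<in> carrier_mat n n"
  shows "mtrace (A * B) = mat_pair n (\<lambda>i j. A $$ (i,j)) (\<lambda>i j. B $$ (j,i))"
  by (simp add: mtrace_mult[OF assms] mat_pair_def)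

lemma qform_add_mat: "qform n (\<lambda>i j. A i j + B i j) x = qform n A x + qform n B x"
  by (simp add: qform_eq_pair mat_pair_add)

lemma qform_diff_mat: "qform n (\<lambda>i j. A i j - B i j) x = qform n A x - qform n B x"
  by (simp add: qform_eq_pair mat_pair_diff)

lemma qform_scale_mat: "qform n (\<lambda>i j. complex_of_real c * A i j) x = c * qform n A x"
  by (simp add: qform_eq_pair mat_pair_scale)

lemma qform_sum_mat: "qform n (\<lambda>i j. \<Sum>m\<in>K. A m i j) x = (\<Sum>m\<in>K. qform n (A m) x)"
  by (simp add: qform_eq_pair mat_pair_sum)

lemma qform_delta: "qform n (\<lambda>i j. of_bool (i = j)) x = sqnorm n x"
proof -
  have "mat_pair n (\<lambda>i j. of_bool (i = j)) (\<lambda>i j. cnj (x i) * x j) = cinner n x x"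
    unfolding mat_pair_delta cinner_def ..
  then show ?thesis unfolding qform_eq_pair cinner_self by simp
qed

lemma hermitian_add: "hermitian n A \<Longrightarrow> hermitian n B \<Longrightarrow> hermitian n (\<lambda>i j. A i j + B i j)"
  unfolding hermitian_def by (metis complex_cnj_add)

lemma hermitian_diff: "hermitian n A \<Longrightarrow> hermitian n B \<Longrightarrow> hermitian n (\<lambda>i j. A i j - B i j)"
  unfolding hermitian_def by (metis complex_cnj_diff)

lemma hermitian_scale: "hermitian n A \<Longrightarrow> hermitian n (\<lambda>i j. complex_of_real c * A i j)"
  unfolding hermitian_def by (metis complex_cnj_mult complex_cnj_complex_of_real)

lemma hermitian_sum:
  assumes "\<And>m. m \<in> K \<Longrightarrow> hermitian n (A m)"
  shows "hermitian n (\<lambda>i j. \<Sum>m\<in>K. A m i j)"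
  unfolding hermitian_def
proof (intro allI impI)
  fix i j assume ij: "i < n" "j < n"
  have "A m i j = cnj (A m j i)" if "m \<in> K" for m
    using hermitianD[OF assms[OF that] ij] by simp
  then show "(\<Sum>m\<in>K. A m i j) = cnj (\<Sum>m\<in>K. A m j i)"
    by simp
qed

lemma hermitian_delta: "hermitian n (\<lambda>i j. of_bool (i = j))"
  by (auto simp: hermitian_def)

lemma qform_diff_vec:
  assumes "hermitian n A"
  shows "qform n A (\<lambda>i. x i - y i) = qform n A x - 2 * Re (cinner n x (mat_app n A y)) + qform n A y"
proof -
  have "cinner n y (mat_app n A x) = cnj (cinner n x (mat_app n A y))"
    using hermitian_cinner[OF assms, of y x] cinner_commute[of n "mat_app n A y" x] by simp
  then show ?thesis
    by (simp add: qform_def mat_app_diff cinner_diff_left cinner_diff_right)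
qed

text \<open>Right side minus left side is the form at \<open>2 x - y\<close>. This splitting of
  \<open>y\<close> as \<open>x + (y - x)\<close> with equal weights is where the choice
  \<open>c = 1\<close> in Hayashi--Nagaoka is made.\<close>

lemma qform_le_double:
  assumes "\<And>x. 0 \<le> qform n A x"
  shows "qform n A y \<le> 2 * qform n A x + 2 * qform n A (\<lambda>i. y i - x i)"
proof -
  have "0 \<le> qform n A (\<lambda>i. (x i + x i) - y i)" by (rule assms)
  then show ?thesis
    by (simp add: qform_def mat_app_diff mat_app_add cinner_diff_left cinner_diff_right
        cinner_add_left cinner_add_right mat_app_scale cinner_scale_left cinner_scale_right)
qed

lemma sqnorm_diff_vec:
  "sqnorm n (\<lambda>i. x i - y i) = sqnorm n x - 2 * Re (cinner n x y) + sqnorm n y"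
proof -
  have "complex_of_real (sqnorm n (\<lambda>i. x i - y i)) =
      complex_of_real (sqnorm n x) - (cinner n x y + cnj (cinner n x y)) + complex_of_real (sqnorm n y)"
    unfolding cinner_self[symmetric] cinner_diff_left cinner_diff_right cinner_commute[of n y x]
    by simp
  also have "\<dots> = complex_of_real (sqnorm n x - 2 * Re (cinner n x y) + sqnorm n y)"
    by (simp add: complex_add_cnj)
  finally show ?thesis by (simp only: of_real_eq_iff)
qed

lemma hermitian_sqnorm:
  assumes "hermitian n A"
  shows "sqnorm n (mat_app n A x) = Re (cinner n x (mat_app n A (mat_app n A x)))"
  unfolding hermitian_cinner[OF assms] cinner_self by simp

text \<open>This is \<open>S\<^sup>2 \<le> S\<close> for \<open>0 \<le> S \<le> 1\<close>, obtained
  without a square root of \<open>S\<close> by evaluating the form at \<open>x - S x\<close> and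
  bounding its last term by the squared norm of \<open>S x\<close>.\<close>

lemma sqnorm_effect_le:
  assumes herm: "hermitian n S" and pos: "\<And>x. 0 \<le> qform n S x"
    and le1: "\<And>x. qform n S x \<le> sqnorm n x"
  shows "sqnorm n (mat_app n S x) \<le> qform n S x"
proof -
  define y where "y = mat_app n S x"
  have "0 \<le> qform n S (\<lambda>i. x i - y i)" by (rule pos)
  also have "\<dots> = qform n S x - 2 * sqnorm n y + qform n S y"
    unfolding qform_diff_vec[OF herm] hermitian_cinner[OF herm] y_def[symmetric] cinner_self by simp
  finally show ?thesis using le1[of y] unfolding y_def by linarith
qed

text \<open>Operator monotonicity of the square root, in the form \<open>S \<le> Q\<^sup>2 \<Longrightarrow> S \<le> Q\<close>, which holds since
  \<open>S\<^sup>2 \<le> S\<close>: test \<open>S \<le> Q\<^sup>2\<close> against an eigenvector of \<open>Q - S\<close> with negative eigenvalue.\<close>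
lemma effect_le_sqrt:
  assumes S: "hermitian n S" "\<And>x. 0 \<le> qform n S x" "\<And>x. qform n S x \<le> sqnorm n x"
    and Q: "hermitian n Q" "\<And>x. 0 \<le> qform n Q x"
    and le: "\<And>x. qform n S x \<le> sqnorm n (mat_app n Q x)"
  shows "qform n S x \<le> qform n Q x"
proof (rule ccontr)
  assume neg: "\<not> qform n S x \<le> qform n Q x"
  define D where "D = (\<lambda>i j. Q i j - S i j)"
  have "qform n D x < 0" using neg by (simp add: D_def qform_diff_mat)
  moreover have "hermitian n D" unfolding D_def by (intro hermitian_diff Q S)
  ultimately obtain \<mu> v where \<mu>: "\<mu> < 0" and v: "sqnorm n v = 1"
    and eig: "\<And>i. i < n \<Longrightarrow> mat_app n D v i = complex_of_real \<mu> * v i"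
    using negative_eigenvector by metis
  define s where "s = qform n S v"
  let ?Sv = "mat_app n S v" and ?\<mu>v = "\<lambda>i. complex_of_real (- \<mu>) * v i"
  have Qv: "mat_app n Q v i = ?Sv i - ?\<mu>v i" if "i < n" for i
    using eig[OF that] by (simp add: D_def mat_app_diff_mat algebra_simps)
  have "cinner n v (mat_app n Q v) = cinner n v (\<lambda>i. ?Sv i - ?\<mu>v i)"
    using Qv by (intro cinner_cong) auto
  then have "qform n Q v = s + \<mu>"
    unfolding cinner_diff_right cinner_scale_right cinner_self v by (simp add: qform_def s_def)
  then have "0 \<le> s + \<mu>" using Q(2)[of v] by simp
  have "sqnorm n (mat_app n Q v) = sqnorm n (\<lambda>i. ?Sv i - ?\<mu>v i)"
    using Qv by (simp add: sqnorm_def)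
  also have "\<dots> = sqnorm n ?Sv + 2 * \<mu> * s + \<mu>\<^sup>2"
  proof -
    have "complex_of_real (sqnorm n ?\<mu>v) = complex_of_real (\<mu>\<^sup>2)"
      unfolding cinner_self[symmetric] cinner_scale_left cinner_scale_right
      unfolding cinner_self v by (simp add: power2_eq_square)
    then have "sqnorm n ?\<mu>v = \<mu>\<^sup>2" by (simp only: of_real_eq_iff)
    then show ?thesis
      unfolding sqnorm_diff_vec cinner_scale_right hermitian_cinner[OF S(1), symmetric]
      by (simp add: qform_def s_def)
  qed
  \<comment> \<open>After cancelling \<open>s\<close> what remains is
    \<open>0 \<le> \<mu> * (2 * s + \<mu>)\<close>. Since \<open>s + \<mu>\<close> is the form of
    \<open>Q\<close> at \<open>v\<close>, it is nonnegative, so \<open>s > 0\<close> and the second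
    factor is positive while \<open>\<mu>\<close> is negative.\<close>
  finally have "s \<le> s + 2 * \<mu> * s + \<mu>\<^sup>2"
    using le[of v] sqnorm_effect_le[OF S, of v] unfolding s_def by linarith
  then have "0 \<le> \<mu> * (2 * s + \<mu>)" by (simp add: algebra_simps power2_eq_square)
  then show False
    using \<mu> \<open>0 \<le> s + \<mu>\<close> by (simp add: zero_le_mult_iff)
qed

text \<open>In operator form, for the square root \<open>Q\<close> of \<open>A\<close> and its inverse \<open>P\<close>:
  \<open>1 - P S P \<le> 2 (1 - S) + 4 (A - S)\<close>.\<close>
lemma hayashi_nagaoka_qform:
  assumes S: "hermitian n S" "\<And>x. 0 \<le> qform n S x" "\<And>x. qform n S x \<le> sqnorm n x"
    and Q: "hermitian n Q" "\<And>x. 0 \<le> qform n Q x"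
    and SA: "\<And>x. qform n S x \<le> qform n A x"
    and QQ: "\<And>x i. i < n \<Longrightarrow> mat_app n Q (mat_app n Q x) i = mat_app n A x i"
    and QP: "\<And>x i. i < n \<Longrightarrow> mat_app n Q (mat_app n P x) i = x i"
  shows "sqnorm n x - qform n S (mat_app n P x) \<le>
    2 * (sqnorm n x - qform n S x) + 4 * (qform n A x - qform n S x)"
proof -
  have sqQ: "sqnorm n (mat_app n Q z) = qform n A z" for z
    unfolding hermitian_sqnorm[OF Q(1)] qform_def using QQ by (intro arg_cong[where f = Re] cinner_cong) auto
  have SQ: "qform n S x \<le> qform n Q x"
    using effect_le_sqrt[OF S Q] SA sqQ by simp
  define y where "y = mat_app n P x"
  define T where "T = (\<lambda>i j. A i j - S i j)"
  have T: "qform n T z = qform n A z - qform n S z" for z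
    unfolding T_def by (rule qform_diff_mat)
  have Qy: "sqnorm n (mat_app n Q y) = sqnorm n x"
    unfolding sqnorm_def using QP by (simp add: y_def)
  \<comment> \<open>Passing from \<open>T\<close> to \<open>A\<close> makes the form a squared norm
    under \<open>Q\<close>, and \<open>Q y = x\<close> removes \<open>y\<close> from it. The cross
    term \<open>- 2 \<langle>x, Q x\<rangle>\<close> is then controlled by
    \<open>S \<le> Q\<close>.\<close>
  have "qform n T (\<lambda>i. y i - x i) \<le> qform n A (\<lambda>i. y i - x i)"
    using S(2) by (simp add: T)
  also have "\<dots> = sqnorm n (\<lambda>i. mat_app n Q y i - mat_app n Q x i)"
    unfolding sqQ[symmetric] mat_app_diff ..
  also have "\<dots> = sqnorm n (\<lambda>i. x i - mat_app n Q x i)"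
    unfolding sqnorm_def using QP by (simp add: y_def)
  also have "\<dots> = sqnorm n x - 2 * qform n Q x + qform n A x"
    unfolding sqnorm_diff_vec sqQ by (simp add: qform_def)
  finally have "qform n T (\<lambda>i. y i - x i) \<le> sqnorm n x - 2 * qform n S x + qform n A x"
    using SQ by simp
  moreover have "qform n T y \<le> 2 * qform n T x + 2 * qform n T (\<lambda>i. y i - x i)"
    using SA by (intro qform_le_double) (simp add: T)
  \<comment> \<open>The quantity to be bounded is itself the form of \<open>T\<close> at
    \<open>y\<close>, because \<open>Q y = x\<close> turns the form of \<open>A\<close> at
    \<open>y\<close> into the squared norm of \<open>x\<close>.\<close>
  moreover have "qform n T y = sqnorm n x - qform n S y"
    using sqQ[of y] Qy by (simp add: T)
  ultimately have "sqnorm n x - qform n S y \<le>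
      2 * (qform n A x - qform n S x) + 2 * (sqnorm n x - 2 * qform n S x + qform n A x)"
    using T[of x] by simp
  then show ?thesis unfolding y_def by (simp add: algebra_simps)
qed

lemma psd_matI:
  assumes "hermitian n A" "\<And>x. 0 \<le> qform n A x"
  shows "psd n (mat n n (\<lambda>(i,j). A i j))"
proof -
  have "qform n (\<lambda>i j. mat n n (\<lambda>(i,j). A i j) $$ (i,j)) x = qform n A x" for x
    by (intro qform_cong) auto
  moreover have "hermitian n (\<lambda>i j. mat n n (\<lambda>(i,j). A i j) $$ (i,j))"
    unfolding hermitian_def using hermitianD[OF assms(1)] by simp
  ultimately show ?thesis
    using assms(2) by (simp add: psd_iff_qform)
qed

text \<open>The operators \<open>P S\<^sub>m P\<close> sum to at most the identity, since the tests
  sum to at most \<open>A = Q\<^sup>2\<close>. The wrong outcomes for \<open>m\<close> together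
  weigh at most \<open>1 - P S\<^sub>m P\<close>, and \<open>A - S\<^sub>m\<close> consists of the
  competing tests and the regulariser.\<close>

lemma hayashi_nagaoka_povm:
  assumes "M \<ge> 1" and S: "\<And>m. m < M \<Longrightarrow> psd n (S m)" "\<And>m. m < M \<Longrightarrow> psd n (1\<^sub>m n - S m)"
    and "\<eta> > 0"
  obtains \<Lambda> where "povm n M \<Lambda>"
    "\<And>m \<rho>. m < M \<Longrightarrow> psd n \<rho> \<Longrightarrow>
       Re (\<Sum>m'\<in>{..<M} - {m}. mtrace (\<Lambda> m' * \<rho>)) \<le>
       2 * (Re (mtrace \<rho>) - Re (mtrace (S m * \<rho>))) +
       4 * ((\<Sum>m'\<in>{..<M} - {m}. Re (mtrace (S m' * \<rho>))) + \<eta> * Re (mtrace \<rho>))"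
proof -
  define s where "s = (\<lambda>m i j. S m $$ (i,j))"
  have carr: "S m \<in> carrier_mat n n" and herm: "hermitian n (s m)" and pos: "0 \<le> qform n (s m) x"
    if "m < M" for m x
    using S(1)[OF that] by (auto simp: psd_iff_qform s_def)
  have le1: "qform n (s m) x \<le> sqnorm n x" if "m < M" for m x
  proof -
    have "qform n (\<lambda>i j. (1\<^sub>m n - S m) $$ (i,j)) x = qform n (\<lambda>i j. of_bool (i = j) - s m i j) x"
      using carr[OF that] by (intro qform_cong) (auto simp: s_def)
    moreover have "0 \<le> qform n (\<lambda>i j. (1\<^sub>m n - S m) $$ (i,j)) x"
      using S(2)[OF that] unfolding psd_iff_qform by blast
    ultimately show ?thesis by (simp add: qform_diff_mat qform_delta)
  qed
  define A where "A = (\<lambda>i j. (\<Sum>m<M. s m i j) + complex_of_real \<eta> * of_bool (i = j))"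
  have qA: "qform n A x = (\<Sum>m<M. qform n (s m) x) + \<eta> * sqnorm n x" for x
    unfolding A_def by (simp add: qform_add_mat qform_sum_mat qform_scale_mat qform_delta)
  have "hermitian n A"
    unfolding A_def using herm
    by (intro hermitian_add hermitian_sum hermitian_scale hermitian_delta) auto
  moreover have "\<eta> * sqnorm n x \<le> qform n A x" for x
    unfolding qA using pos by (auto intro: sum_nonneg)
  ultimately obtain Q P where Q: "hermitian n Q" "\<And>x. 0 \<le> qform n Q x" and P: "hermitian n P"
    and QQ: "\<And>x i. i < n \<Longrightarrow> mat_app n Q (mat_app n Q x) i = mat_app n A x i"
    and QP: "\<And>x i. i < n \<Longrightarrow> mat_app n Q (mat_app n P x) i = x i"
    using positive_definite_sqrt[of n A \<eta>] \<open>\<eta> > 0\<close> by metis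
  \<comment> \<open>Entry \<open>(i, j)\<close> of the product \<open>P S\<^sub>m P\<close>, written
    as \<open>P S\<^sub>m\<close> applied to column \<open>j\<close> of \<open>P\<close>.\<close>
  define E where "E = (\<lambda>m i j. mat_app n P (mat_app n (s m) (\<lambda>b. P b j)) i)"
  have appE: "mat_app n (E m) x = mat_app n P (mat_app n (s m) (mat_app n P x))" for m x
  proof -
    have comp: "(\<Sum>j<n. mat_app n B (\<lambda>b. C b j) i * x j) = mat_app n B (mat_app n C x) i" for B C i
    proof -
      have "(\<Sum>j<n. mat_app n B (\<lambda>b. C b j) i * x j) = (\<Sum>j<n. \<Sum>b<n. B i b * (C b j * x j))"
        by (simp add: mat_app_def sum_distrib_right mult.assoc)
      also have "\<dots> = (\<Sum>b<n. \<Sum>j<n. B i b * (C b j * x j))" by (rule sum.swap)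
      finally show ?thesis by (simp add: mat_app_def sum_distrib_left)
    qed
    have "mat_app n (E m) x i = mat_app n P (mat_app n (s m) (mat_app n P x)) i" for i
    proof -
      have "mat_app n (E m) x i = mat_app n P (mat_app n (\<lambda>a j. mat_app n (s m) (\<lambda>b. P b j) a) x) i"
        unfolding E_def mat_app_def[of n "\<lambda>i j. mat_app n P (mat_app n (s m) (\<lambda>b. P b j)) i"]
        using comp[of P "\<lambda>a j. mat_app n (s m) (\<lambda>b. P b j) a" i] by simp
      also have "mat_app n (\<lambda>a j. mat_app n (s m) (\<lambda>b. P b j) a) x = mat_app n (s m) (mat_app n P x)"
        unfolding mat_app_def[of n "\<lambda>a j. mat_app n (s m) (\<lambda>b. P b j) a"]
        using comp[of "s m" P] by (simp add: fun_eq_iff)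
      finally show ?thesis .
    qed
    then show ?thesis by auto
  qed
  have innerE: "cinner n x (mat_app n (E m) x) = complex_of_real (qform n (s m) (mat_app n P x))"
    if "m < M" for m x
    unfolding appE hermitian_cinner[OF P] using hermitian_qform[OF herm[OF that]] .
  have hermE: "hermitian n (E m)" if "m < M" for m
    using innerE[OF that] by (intro hermitian_if_real_form) simp
  have qE: "qform n (E m) x = qform n (s m) (mat_app n P x)" if "m < M" for m x
    unfolding qform_def innerE[OF that] by (simp add: qform_def)
  define R where "R = (\<lambda>i j. of_bool (i = j) - (\<Sum>m<M. E m i j))"
  have hermR: "hermitian n R"
    unfolding R_def using hermE by (intro hermitian_diff hermitian_delta hermitian_sum) auto
  have qR: "0 \<le> qform n R x" for x
  proof -
    define y where "y = mat_app n P x"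
    have "(\<Sum>m<M. qform n (s m) y) \<le> qform n A y"
      unfolding qA using \<open>\<eta> > 0\<close> sqnorm_nonneg[of n y] by simp
    also have "\<dots> = sqnorm n (mat_app n Q y)"
      unfolding hermitian_sqnorm[OF Q(1)] qform_def using QQ
      by (intro arg_cong[where f = Re] cinner_cong) auto
    also have "\<dots> = sqnorm n x"
      unfolding sqnorm_def using QP by (simp add: y_def)
    finally show ?thesis
      unfolding R_def qform_diff_mat qform_delta qform_sum_mat using qE by (simp add: y_def)
  qed
  \<comment> \<open>The deficit \<open>R\<close> has to go to some outcome for the sum to be exactly
    the identity. Giving it to outcome 0, which exists as \<open>M \<ge> 1\<close>, only enlarges
    that operator, so every lower bound by \<open>P S\<^sub>m P\<close> survives.\<close>
  define L where "L = (\<lambda>m i j. E m i j + (if m = 0 then R i j else 0))"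
  have L: "hermitian n (L m)" "qform n (s m) (mat_app n P x) \<le> qform n (L m) x" if "m < M" for m x
  proof -
    have "L m = (if m = 0 then (\<lambda>i j. E m i j + R i j) else E m)"
      by (auto simp: L_def fun_eq_iff)
    then show "hermitian n (L m)" "qform n (s m) (mat_app n P x) \<le> qform n (L m) x"
      using hermE[OF that] hermR qE[OF that] qR by (auto simp: hermitian_add qform_add_mat)
  qed
  have posL: "0 \<le> qform n (L m) x" if "m < M" for m x
    using L(2)[OF that] pos[OF that] order_trans by blast
  have sumL: "(\<Sum>m<M. L m i j) = of_bool (i = j)" for i j
  proof -
    have "(\<Sum>m<M. L m i j) = (\<Sum>m<M. E m i j) + (\<Sum>m<M. if m = 0 then R i j else 0)"
      by (simp add: L_def sum.distrib)
    also have "(\<Sum>m<M. if m = 0 then R i j else 0) = R i j"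
      using \<open>M \<ge> 1\<close> by (simp add: sum.delta)
    finally show ?thesis by (simp add: R_def)
  qed
  define \<Lambda> where "\<Lambda> = (\<lambda>m. mat n n (\<lambda>(i,j). L m i j))"
  have "povm n M \<Lambda>"
    unfolding povm_def \<Lambda>_def using L(1) posL sumL by (auto intro!: psd_matI)
  moreover have "Re (\<Sum>m'\<in>{..<M} - {m}. mtrace (\<Lambda> m' * \<rho>)) \<le>
       2 * (Re (mtrace \<rho>) - Re (mtrace (S m * \<rho>))) +
       4 * ((\<Sum>m'\<in>{..<M} - {m}. Re (mtrace (S m' * \<rho>))) + \<eta> * Re (mtrace \<rho>))"
    if m: "m < M" and \<rho>: "psd n \<rho>" for m \<rho>
  proof -
    let ?K = "{..<M} - {m}"
    \<comment> \<open>Upper bound minus error operator. Its positivity is checked on vectors, and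
      pairing it with \<open>\<rho>\<close> yields the claim.\<close>
    define W where "W = (\<lambda>i j. complex_of_real 2 * (of_bool (i = j) - s m i j) +
      complex_of_real 4 * ((\<Sum>m'\<in>?K. s m' i j) + complex_of_real \<eta> * of_bool (i = j)) -
      (\<Sum>m'\<in>?K. L m' i j))"
    have hermW: "hermitian n W"
      unfolding W_def using herm[OF m] herm L(1)
      by (intro hermitian_add hermitian_diff hermitian_sum hermitian_scale hermitian_delta) auto
    have qW: "0 \<le> qform n W x" for x
    proof -
      have split: "(\<Sum>m'<M. f m') = f m + (\<Sum>m'\<in>?K. f m')" for f :: "nat \<Rightarrow> real"
        using m by (intro sum.remove) auto
      have "(\<Sum>m'<M. qform n (L m') x) = sqnorm n x"
        using qform_sum_mat[of n L "{..<M}" x] sumL by (simp add: qform_delta)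
      then have 1: "(\<Sum>m'\<in>?K. qform n (L m') x) \<le> sqnorm n x - qform n (s m) (mat_app n P x)"
        using split[of "\<lambda>m'. qform n (L m') x"] L(2)[OF m, of x] by simp
      have "qform n (s m) z \<le> qform n A z" for z
        unfolding qA split[of "\<lambda>m'. qform n (s m') z"]
        using pos \<open>\<eta> > 0\<close> sqnorm_nonneg[of n z] by (auto intro!: add_nonneg_nonneg sum_nonneg)
      then have "sqnorm n x - qform n (s m) (mat_app n P x) \<le>
          2 * (sqnorm n x - qform n (s m) x) + 4 * (qform n A x - qform n (s m) x)"
        using herm[OF m] pos[OF m] le1[OF m] Q QQ QP by (intro hayashi_nagaoka_qform[where Q = Q]) auto
      also have "qform n A x - qform n (s m) x = (\<Sum>m'\<in>?K. qform n (s m') x) + \<eta> * sqnorm n x"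
        unfolding qA split[of "\<lambda>m'. qform n (s m') x"] by simp
      finally show ?thesis
        using 1 unfolding W_def qform_add_mat qform_diff_mat qform_scale_mat qform_sum_mat qform_delta
        by linarith
    qed
    have c\<rho>: "\<rho> \<in> carrier_mat n n" using \<rho> by (simp add: psd_def)
    let ?w = "\<lambda>i j. \<rho> $$ (j,i)"
    have "0 \<le> Re (mtrace (mat n n (\<lambda>(i,j). W i j) * \<rho>))"
      by (intro psd_trace_mult_nonneg[of n] psd_matI hermW qW \<rho>)
    also have "mtrace (mat n n (\<lambda>(i,j). W i j) * \<rho>) = mat_pair n W ?w"
      using c\<rho> by (subst mtrace_eq_pair) (auto intro: mat_pair_cong)
    finally have W0: "0 \<le> Re (mat_pair n W ?w)" .
    have tr\<rho>: "mat_pair n (\<lambda>i j. of_bool (i = j)) ?w = mtrace \<rho>"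
      unfolding mat_pair_delta mtrace_def using c\<rho> by simp
    have trS: "mat_pair n (s m') ?w = mtrace (S m' * \<rho>)" if "m' < M" for m'
      unfolding mtrace_eq_pair[OF carr[OF that] c\<rho>] s_def ..
    have trL: "mat_pair n (L m') ?w = mtrace (\<Lambda> m' * \<rho>)" for m'
      using c\<rho> unfolding \<Lambda>_def by (subst mtrace_eq_pair) (auto intro: mat_pair_cong)
    have "mat_pair n W ?w = complex_of_real 2 * (mtrace \<rho> - mtrace (S m * \<rho>)) +
        complex_of_real 4 * ((\<Sum>m'\<in>?K. mtrace (S m' * \<rho>)) + complex_of_real \<eta> * mtrace \<rho>) -
        (\<Sum>m'\<in>?K. mtrace (\<Lambda> m' * \<rho>))"
      unfolding W_def mat_pair_add mat_pair_diff mat_pair_scale mat_pair_sum tr\<rho> trS[OF m] trL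
      using trS by simp
    then show ?thesis using W0 by simp
  qed
  ultimately show ?thesis by (rule that)
qed

section \<open>Kraus maps and channels\<close>

lemma sum_lessThan_mult:
  fixes f :: "nat \<Rightarrow> 'a::comm_monoid_add"
  shows "(\<Sum>p<a * b. f p) = (\<Sum>i<a. \<Sum>j<b. f (i * b + j))"
proof -
  have "(\<Sum>j<b. f (i * b + j)) = sum f {i * b..<i * b + b}" for i
    using sum.shift_bounds_nat_ivl[of f 0 "i * b" b]
    by (simp add: lessThan_atLeast0 add.commute)
  then show ?thesis by (simp add: sum.nat_group)
qed

lemma mult_add_less: "i < a \<Longrightarrow> j < b \<Longrightarrow> i * b + j < a * (b::nat)"
  using mult_le_mono1[of "Suc i" a b] by simp

lemma sum_of_bool_mod:
  fixes F :: "nat \<Rightarrow> complex"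
  assumes "c < k"
  shows "(\<Sum>I<n * k. of_bool (P (I div k) \<and> I mod k = c) * F I) = (\<Sum>i<n. of_bool (P i) * F (i * k + c))"
proof -
  have "(\<Sum>j<k. of_bool (P ((i * k + j) div k) \<and> (i * k + j) mod k = c) * F (i * k + j)) =
      (\<Sum>j<k. if j = c then of_bool (P i) * F (i * k + j) else 0)" for i
    using assms by (intro sum.cong) auto
  then show ?thesis
    unfolding sum_lessThan_mult using assms by (simp add: sum.delta)
qed

lemma sum_of_bool_eq:
  fixes f :: "nat \<Rightarrow> complex"
  assumes "a < n"
  shows "(\<Sum>x<n. of_bool (x = a) * f x) = f a"
proof -
  have "(\<Sum>x<n. of_bool (x = a) * f x) = (\<Sum>x<n. if x = a then f x else 0)"
    by (intro sum.cong) auto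
  then show ?thesis using assms by (simp add: sum.delta)
qed

text \<open>Each summand is a conjugation of \<open>X\<close> by \<open>K s\<close>, and its form at
  \<open>x\<close> is the form of \<open>X\<close> at the adjoint of \<open>K s\<close> applied to
  \<open>x\<close>, called \<open>u s x\<close> below.\<close>

lemma psd_kraus:
  assumes X: "psd n X"
  shows "psd k (mat k k (\<lambda>(p,q). \<Sum>s\<in>S. \<Sum>i<n. \<Sum>j<n. K s p i * X $$ (i,j) * cnj (K s q j)))"
proof -
  let ?X = "\<lambda>i j. X $$ (i,j)"
  have hermX: "hermitian n ?X" and posX: "\<And>x. 0 \<le> qform n ?X x"
    using X by (auto simp: psd_iff_qform)
  define Y where "Y = (\<lambda>s p q. \<Sum>i<n. \<Sum>j<n. K s p i * X $$ (i,j) * cnj (K s q j))"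
  define u where "u = (\<lambda>s x j. \<Sum>q<k. cnj (K s q j) * x q)"
  have app: "mat_app k (Y s) x p = (\<Sum>i<n. K s p i * mat_app n ?X (u s x) i)" for s x p
  proof -
    have "mat_app k (Y s) x p = (\<Sum>q<k. \<Sum>i<n. \<Sum>j<n. K s p i * (X $$ (i,j) * (cnj (K s q j) * x q)))"
      by (simp add: mat_app_def Y_def sum_distrib_right mult.assoc)
    also have "\<dots> = (\<Sum>i<n. \<Sum>q<k. \<Sum>j<n. K s p i * (X $$ (i,j) * (cnj (K s q j) * x q)))"
      by (rule sum.swap)
    also have "\<dots> = (\<Sum>i<n. \<Sum>j<n. \<Sum>q<k. K s p i * (X $$ (i,j) * (cnj (K s q j) * x q)))"
      by (intro sum.cong refl sum.swap)
    finally show ?thesis by (simp add: mat_app_def u_def sum_distrib_left)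
  qed
  have inner: "cinner k x (mat_app k (Y s) x) = complex_of_real (qform n ?X (u s x))" for s x
  proof -
    have "cinner k x (mat_app k (Y s) x) =
        (\<Sum>p<k. \<Sum>i<n. K s p i * cnj (x p) * mat_app n ?X (u s x) i)"
      by (simp add: cinner_def app sum_distrib_left mult_ac)
    also have "\<dots> = (\<Sum>i<n. \<Sum>p<k. K s p i * cnj (x p) * mat_app n ?X (u s x) i)"
      by (rule sum.swap)
    also have "\<dots> = cinner n (u s x) (mat_app n ?X (u s x))"
      by (simp add: cinner_def u_def sum_distrib_right)
    finally show ?thesis using hermitian_qform[OF hermX] by simp
  qed
  have "hermitian k (Y s)" for s
    by (rule hermitian_if_real_form) (simp add: inner)
  moreover have "0 \<le> qform k (Y s) x" for s x
    unfolding qform_def[of k] inner using posX by simp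
  ultimately have "psd k (mat k k (\<lambda>(p,q). \<Sum>s\<in>S. Y s p q))"
    by (intro psd_matI) (auto intro: hermitian_sum sum_nonneg simp: qform_sum_mat)
  then show ?thesis unfolding Y_def .
qed

text \<open>Indices with different labels \<open>r\<close> do not interact. One Kraus operator per
  label, sending \<open>p\<close> to \<open>\<pi> p\<close> inside its block, realises the matrix;
  with suitable \<open>r\<close> and \<open>\<pi>\<close> this is a tensor product with an
  identity.\<close>

lemma psd_pullback:
  assumes X: "psd k X" and \<pi>: "\<And>p. p < n \<Longrightarrow> \<pi> p < k"
  shows "psd n (mat n n (\<lambda>(p,q). of_bool (r p = r q) * X $$ (\<pi> p, \<pi> q)))"
proof -
  define K :: "'a \<Rightarrow> nat \<Rightarrow> nat \<Rightarrow> complex" where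
    "K = (\<lambda>s p i. of_bool (r p = s) * of_bool (i = \<pi> p))"
  have "(\<Sum>s\<in>r ` {..<n}. \<Sum>i<k. \<Sum>j<k. K s p i * X $$ (i,j) * cnj (K s q j)) =
      of_bool (r p = r q) * X $$ (\<pi> p, \<pi> q)" if "p < n" "q < n" for p q
  proof -
    have "(\<Sum>i<k. \<Sum>j<k. K s p i * X $$ (i,j) * cnj (K s q j)) =
        (if s = r p then of_bool (r p = r q) * X $$ (\<pi> p, \<pi> q) else 0)" for s
    proof -
      have "(\<Sum>i<k. \<Sum>j<k. K s p i * X $$ (i,j) * cnj (K s q j)) =
          (\<Sum>i<k. of_bool (i = \<pi> p) * (\<Sum>j<k. of_bool (j = \<pi> q) *
            (of_bool (r p = s \<and> r q = s) * X $$ (i,j))))"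
        unfolding sum_distrib_left by (intro sum.cong refl) (auto simp: K_def)
      then show ?thesis using \<pi> that by (auto simp: sum_of_bool_eq)
    qed
    then show ?thesis using that by (simp add: sum.delta)
  qed
  then have "mat n n (\<lambda>(p,q). of_bool (r p = r q) * X $$ (\<pi> p, \<pi> q)) =
      mat n n (\<lambda>(p,q). \<Sum>s\<in>r ` {..<n}. \<Sum>i<k. \<Sum>j<k. K s p i * X $$ (i,j) * cnj (K s q j))"
    by (intro eq_matI) auto
  then show ?thesis using psd_kraus[OF X, where k = n and S = "r ` {..<n}" and K = K] by (simp only:)
qed

lemma psd_rank_one: "psd n (mat n n (\<lambda>(i,j). w i * cnj (w j)))"
proof -
  have "spectral_sum 1 (\<lambda>_. 1) (\<lambda>_. w) = (\<lambda>i j. w i * cnj (w j))"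
    by (simp add: spectral_sum_def fun_eq_iff)
  then show ?thesis
    using psd_matI[OF hermitian_spectral_sum, of n 1 "\<lambda>_. 1" "\<lambda>_. w"]
      qform_spectral_sum[of n 1 "\<lambda>_. 1" "\<lambda>_. w"] by simp
qed

lemma psd_pure_state: "pure_state n \<psi> \<Longrightarrow> psd n \<psi>"
  unfolding pure_state_def using psd_rank_one by auto

lemma mtrace_pure_state: "pure_state n \<psi> \<Longrightarrow> mtrace \<psi> = 1"
proof -
  assume "pure_state n \<psi>"
  then obtain v where v: "(\<Sum>i<n. (cmod (v $ i))\<^sup>2) = 1" "\<psi> = mat n n (\<lambda>(i,j). v $ i * cnj (v $ j))"
    unfolding pure_state_def by blast
  have "mtrace \<psi> = complex_of_real (\<Sum>i<n. (cmod (v $ i))\<^sup>2)"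
    unfolding of_real_sum complex_norm_square by (simp add: mtrace_def v(2))
  then show ?thesis using v(1) by simp
qed

lemma channelD:
  assumes "channel dA dB N" "X \<in> carrier_mat dA dA"
  shows "N X \<in> carrier_mat dB dB" "mtrace (N X) = mtrace X"
  using assms by (auto simp: channel_def)

lemma channel_smult:
  assumes N: "channel dA dB N" and X: "X \<in> carrier_mat dA dA"
  shows "N (c \<cdot>\<^sub>m X) = c \<cdot>\<^sub>m N X"
proof -
  \<comment> \<open>Linearity of a channel is given in the single form \<open>c X + Y\<close>; this
    choice of the second summand isolates the scalar without a value at the zero matrix.\<close>
  have "c \<cdot>\<^sub>m X = (c - 1) \<cdot>\<^sub>m X + X"
    using X by (intro eq_matI) (auto simp: algebra_simps)
  then have "N (c \<cdot>\<^sub>m X) = (c - 1) \<cdot>\<^sub>m N X + N X"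
    using N X by (simp add: channel_def)
  also have "\<dots> = c \<cdot>\<^sub>m N X"
    using channelD(1)[OF N X] by (intro eq_matI) (auto simp: algebra_simps)
  finally show ?thesis .
qed

lemma channel_sum:
  assumes N: "channel dA dB N" and "finite K" and "b < dB" "b' < dB"
  shows "N (mat dA dA (\<lambda>ij. \<Sum>x\<in>K. F x ij)) $$ (b,b') = (\<Sum>x\<in>K. N (mat dA dA (F x)) $$ (b,b'))"
  using \<open>finite K\<close>
proof (induction K rule: finite_induct)
  case empty
  let ?Z = "mat dA dA (\<lambda>ij. 0) :: complex mat"
  have "N (0 \<cdot>\<^sub>m ?Z) = 0 \<cdot>\<^sub>m N ?Z" by (intro channel_smult[OF N]) simp
  moreover have "0 \<cdot>\<^sub>m ?Z = ?Z" by (intro eq_matI) auto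
  ultimately have "N ?Z $$ (b,b') = (0 \<cdot>\<^sub>m N ?Z) $$ (b,b')" by simp
  then show ?case using channelD(1)[OF N, of ?Z] assms by simp
next
  case (insert x K)
  let ?X = "mat dA dA (F x)" and ?Y = "mat dA dA (\<lambda>ij. \<Sum>x\<in>K. F x ij)"
  have "mat dA dA (\<lambda>ij. \<Sum>x\<in>insert x K. F x ij) = 1 \<cdot>\<^sub>m ?X + ?Y"
    using insert.hyps by (intro eq_matI) auto
  then have "N (mat dA dA (\<lambda>ij. \<Sum>x\<in>insert x K. F x ij)) = 1 \<cdot>\<^sub>m N ?X + N ?Y"
    using N by (simp add: channel_def)
  then show ?case
    using channelD(1)[OF N, of ?X] channelD(1)[OF N, of ?Y] assms insert by simp
qed

lemma mtrace_tensor_id: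
  assumes N: "channel dA dB N" and X: "X \<in> carrier_mat (dA * k) (dA * k)"
  shows "mtrace (tensor_id N dA dB k X) = mtrace X"
proof -
  let ?X = "\<lambda>c. mat dA dA (\<lambda>(i,j). X $$ (i * k + c, j * k + c))"
  have "mtrace (tensor_id N dA dB k X) = (\<Sum>b<dB. \<Sum>c<k. N (?X c) $$ (b,b))"
    by (simp add: mtrace_def tensor_id_def sum_lessThan_mult mult_add_less)
  also have "\<dots> = (\<Sum>c<k. \<Sum>b<dB. N (?X c) $$ (b,b))" by (rule sum.swap)
  also have "\<dots> = (\<Sum>c<k. mtrace (N (?X c)))"
  proof (rule sum.cong[OF refl])
    fix c
    have "N (?X c) \<in> carrier_mat dB dB" by (intro channelD(1)[OF N]) simp
    then show "(\<Sum>b<dB. N (?X c) $$ (b,b)) = mtrace (N (?X c))" by (simp add: mtrace_def)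
  qed
  also have "\<dots> = (\<Sum>c<k. mtrace (?X c))"
    using channelD(2)[OF N] by simp
  also have "\<dots> = (\<Sum>c<k. \<Sum>i<dA. X $$ (i * k + c, i * k + c))"
    by (simp add: mtrace_def)
  also have "\<dots> = mtrace X"
    using X by (subst sum.swap) (simp add: mtrace_def sum_lessThan_mult)
  finally show ?thesis .
qed

section \<open>Position-based coding\<close>

text \<open>Equal cardinality suffices: later arguments use only that \<open>D\<close> enumerates
  all strings of length \<open>M\<close>, not the arithmetic of a positional system.\<close>

lemma ex_digits: "\<exists>D. bij_betw D {..<d ^ M} (PiE {..<M} (\<lambda>_. {..<d::nat}))"
proof -
  have "card (PiE {..<M} (\<lambda>_. {..<d})) = d ^ M"
    by (simp add: card_PiE)
  then show ?thesis
    by (intro finite_same_card_bij) (auto intro: finite_PiE)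
qed

text \<open>\<open>D e j\<close> plays the role of the \<open>j\<close>-th digit of the index \<open>e\<close> of an \<open>M\<close>-fold tensor power.\<close>
locale digits =
  fixes d M :: nat and D :: "nat \<Rightarrow> nat \<Rightarrow> nat"
  assumes bij: "bij_betw D {..<d ^ M} (PiE {..<M} (\<lambda>_. {..<d}))"
begin

abbreviation n where "n \<equiv> d ^ M"

text \<open>The position \<open>m\<close> is overwritten rather than deleted, so equality of two
  such strings says that they agree at all other positions, with no renumbering.\<close>

definition rest :: "nat \<Rightarrow> nat \<Rightarrow> nat \<Rightarrow> nat" where
  "rest m e = (D e)(m := 0)"

lemma digit_less: "e < n \<Longrightarrow> j < M \<Longrightarrow> D e j < d"
  using bij_betwE[OF bij] by (auto simp: PiE_iff)

lemma digits_inject: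
  assumes "rest m e = rest m e'" "D e m = D e' m" "e < n" "e' < n"
  shows "e = e'"
proof -
  have "D e = D e'"
    using assms(1,2) unfolding rest_def by (metis fun_upd_triv fun_upd_upd)
  then show ?thesis
    using bij assms(3,4) by (auto simp: bij_betw_def inj_on_def)
qed

text \<open>The delta on the untouched positions is put in the same product form as tensor-power
  entries, so that the two can be multiplied factor by factor. Extensionality of the strings settles
  the arguments from \<open>M\<close> on.\<close>

lemma rest_eq_prod:
  assumes "e < n" "e' < n"
  shows "of_bool (rest m e = rest m e') =
    (\<Prod>j<M. if j = m then 1 else of_bool (D e j = D e' j) :: complex)"
proof -
  have ext: "D e j = D e' j" if "\<not> j < M" for j
    using bij_betwE[OF bij] assms that by (auto simp: PiE_iff extensional_def)
  have "rest m e = rest m e' \<longleftrightarrow> (\<forall>j<M. j \<noteq> m \<longrightarrow> D e j = D e' j)"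
    unfolding rest_def fun_eq_iff using ext by auto
  moreover have "(\<Prod>j<M. if j = m then 1 else of_bool (D e j = D e' j) :: complex) =
      of_bool (\<forall>j<M. j \<noteq> m \<longrightarrow> D e j = D e' j)"
  proof (cases "\<forall>j<M. j \<noteq> m \<longrightarrow> D e j = D e' j")
    case True
    then show ?thesis by (auto intro!: prod.neutral)
  next
    case False
    then show ?thesis by (auto intro!: prod_zero)
  qed
  ultimately show ?thesis by simp
qed

text \<open>Distributivity over all strings; this is the factorisation of a trace over tensor
  factors.\<close>

lemma sum_prod_digits:
  fixes f :: "nat \<Rightarrow> nat \<Rightarrow> complex"
  shows "(\<Sum>e<n. \<Prod>j<M. f j (D e j)) = (\<Prod>j<M. \<Sum>x<d. f j x)"
  using sum.reindex_bij_betw[OF bij, of "\<lambda>g. \<Prod>j<M. f j (g j)"] by (simp add: prod_sum_PiE)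

lemma sum_prod_digits2:
  fixes f :: "nat \<Rightarrow> nat \<Rightarrow> nat \<Rightarrow> complex"
  shows "(\<Sum>e<n. \<Sum>e'<n. \<Prod>j<M. f j (D e j) (D e' j)) = (\<Prod>j<M. \<Sum>x<d. \<Sum>y<d. f j x y)"
  using sum_prod_digits[of "\<lambda>j y. f j (D _ j) y"] sum_prod_digits[of "\<lambda>j x. \<Sum>y<d. f j x y"]
  by simp

text \<open>The partial trace over all factors except the \<open>m\<close>-th, that is, Alice
  discarding her other halves.\<close>

definition select :: "nat \<Rightarrow> cmat \<Rightarrow> cmat" where
  "select m X = mat d d (\<lambda>(a,a'). \<Sum>i<n. \<Sum>i'<n.
     of_bool (D i m = a \<and> D i' m = a' \<and> rest m i = rest m i') * X $$ (i,i'))"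

lemma tensor_id_select:
  assumes "p < d * k" "q < d * k"
  shows "tensor_id (select m) n d k X $$ (p,q) = (\<Sum>i<n. \<Sum>i'<n.
    of_bool (D i m = p div k \<and> D i' m = q div k \<and> rest m i = rest m i') *
    X $$ (i * k + p mod k, i' * k + q mod k))"
proof -
  have "p div k < d" "q div k < d"
    using assms by (simp_all add: less_mult_imp_div_less)
  then show ?thesis using assms by (simp add: tensor_id_def select_def)
qed

lemma channel_select:
  assumes "m < M"
  shows "channel n d (select m)"
  unfolding channel_def
proof (intro conjI ballI allI impI)
  fix X :: cmat assume X: "X \<in> carrier_mat n n"
  show "select m X \<in> carrier_mat d d" by (simp add: select_def)
  show "mtrace (select m X) = mtrace X"
  proof -
    have "mtrace (select m X) = (\<Sum>a<d. \<Sum>i<n. \<Sum>i'<n.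
       of_bool (D i m = a \<and> D i' m = a \<and> rest m i = rest m i') * X $$ (i,i'))"
      by (simp add: mtrace_def select_def)
    also have "\<dots> = (\<Sum>i<n. \<Sum>a<d. \<Sum>i'<n.
       of_bool (D i m = a \<and> D i' m = a \<and> rest m i = rest m i') * X $$ (i,i'))"
      by (rule sum.swap)
    also have "\<dots> = (\<Sum>i<n. X $$ (i,i))"
    proof (intro sum.cong refl)
      fix i assume "i \<in> {..<n}"
      then have i: "i < n" by simp
      \<comment> \<open>Agreement at position \<open>m\<close> and off it forces
        \<open>i' = i\<close>, so only the diagonal of \<open>X\<close> survives.\<close>
      have 1: "(\<Sum>i'<n. of_bool (D i m = a \<and> D i' m = a \<and> rest m i = rest m i') * X $$ (i,i')) =
          (\<Sum>i'<n. of_bool (i' = i) * (of_bool (a = D i m) * X $$ (i,i')))" for a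
      proof (rule sum.cong[OF refl])
        fix i' assume "i' \<in> {..<n}"
        then show "of_bool (D i m = a \<and> D i' m = a \<and> rest m i = rest m i') * X $$ (i,i') =
            of_bool (i' = i) * (of_bool (a = D i m) * X $$ (i,i'))"
          using digits_inject[of m i i'] i by (cases "i' = i") auto
      qed
      show "(\<Sum>a<d. \<Sum>i'<n. of_bool (D i m = a \<and> D i' m = a \<and> rest m i = rest m i') * X $$ (i,i')) =
          X $$ (i,i)"
        unfolding 1 sum_of_bool_eq[OF i] sum_of_bool_eq[OF digit_less[OF i assms]] ..
    qed
    finally show ?thesis using X by (simp add: mtrace_def)
  qed
  fix Y :: cmat and c assume Y: "Y \<in> carrier_mat n n"
  show "select m (c \<cdot>\<^sub>m X + Y) = c \<cdot>\<^sub>m select m X + select m Y"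
    using X Y by (intro eq_matI)
      (simp_all add: select_def distrib_left sum.distrib sum_distrib_left mult.left_commute
        del: sum_of_bool_mult_eq sum_mult_of_bool_eq)
next
  fix k X assume X: "psd (n * k) X"
  \<comment> \<open>Complete positivity by Kraus operators: \<open>K s\<close> projects the
    discarded positions onto the configuration \<open>s\<close> and acts as the identity on position
    \<open>m\<close> and on the reference system of dimension \<open>k\<close>.\<close>
  define K where "K = (\<lambda>s p I. of_bool ((rest m (I div k) = s \<and> D (I div k) m = p div k) \<and>
    I mod k = p mod k) :: complex)"
  have "tensor_id (select m) n d k X $$ (p,q) = (\<Sum>s\<in>rest m ` {..<n}. \<Sum>I<n * k. \<Sum>J<n * k.
      K s p I * X $$ (I,J) * cnj (K s q J))" if pq: "p < d * k" "q < d * k" for p q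
  proof -
    have k: "p mod k < k" "q mod k < k" using pq by (cases k; simp)+
    let ?x = "\<lambda>i i'. X $$ (i * k + p mod k, i' * k + q mod k)"
    have "(\<Sum>s\<in>rest m ` {..<n}. \<Sum>I<n * k. \<Sum>J<n * k. K s p I * X $$ (I,J) * cnj (K s q J)) =
        (\<Sum>s\<in>rest m ` {..<n}. \<Sum>i<n. \<Sum>i'<n.
          of_bool (rest m i = s \<and> D i m = p div k) * (of_bool (rest m i' = s \<and> D i' m = q div k) * ?x i i'))"
    proof (rule sum.cong[OF refl])
      fix s
      have "(\<Sum>I<n * k. \<Sum>J<n * k. K s p I * X $$ (I,J) * cnj (K s q J)) =
        (\<Sum>I<n * k. K s p I * (\<Sum>J<n * k. K s q J * X $$ (I,J)))"
        unfolding sum_distrib_left by (intro sum.cong refl) (auto simp: K_def)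
      also have "\<dots> = (\<Sum>i<n. of_bool (rest m i = s \<and> D i m = p div k) *
          (\<Sum>i'<n. of_bool (rest m i' = s \<and> D i' m = q div k) * ?x i i'))"
        unfolding K_def sum_of_bool_mod[OF k(1), of "\<lambda>i. rest m i = s \<and> D i m = p div k"]
          sum_of_bool_mod[OF k(2), of "\<lambda>i. rest m i = s \<and> D i m = q div k"] ..
      finally show "(\<Sum>I<n * k. \<Sum>J<n * k. K s p I * X $$ (I,J) * cnj (K s q J)) =
        (\<Sum>i<n. \<Sum>i'<n.
          of_bool (rest m i = s \<and> D i m = p div k) * (of_bool (rest m i' = s \<and> D i' m = q div k) * ?x i i'))"
        by (simp only: sum_distrib_left)
    qed
    also have "\<dots> = (\<Sum>i<n. \<Sum>s\<in>rest m ` {..<n}. \<Sum>i'<n.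
          of_bool (rest m i = s \<and> D i m = p div k) * (of_bool (rest m i' = s \<and> D i' m = q div k) * ?x i i'))"
      by (rule sum.swap)
    also have "\<dots> = (\<Sum>i<n. \<Sum>i'<n. \<Sum>s\<in>rest m ` {..<n}.
          of_bool (rest m i = s \<and> D i m = p div k) * (of_bool (rest m i' = s \<and> D i' m = q div k) * ?x i i'))"
      by (intro sum.cong refl sum.swap)
    also have "\<dots> = (\<Sum>i<n. \<Sum>i'<n.
      of_bool (D i m = p div k \<and> D i' m = q div k \<and> rest m i = rest m i') * ?x i i')"
    proof (intro sum.cong refl)
      fix i i' assume "i \<in> {..<n}" "i' \<in> {..<n}"
      have "(\<Sum>s\<in>rest m ` {..<n}.
          of_bool (rest m i = s \<and> D i m = p div k) * (of_bool (rest m i' = s \<and> D i' m = q div k) * ?x i i')) =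
          (\<Sum>s\<in>rest m ` {..<n}. if s = rest m i then
            of_bool (D i m = p div k \<and> D i' m = q div k \<and> rest m i = rest m i') * ?x i i' else 0)"
        by (intro sum.cong) auto
      then show "(\<Sum>s\<in>rest m ` {..<n}.
          of_bool (rest m i = s \<and> D i m = p div k) * (of_bool (rest m i' = s \<and> D i' m = q div k) * ?x i i')) =
          of_bool (D i m = p div k \<and> D i' m = q div k \<and> rest m i = rest m i') * ?x i i'"
        using \<open>i \<in> {..<n}\<close> by (simp add: sum.delta)
    qed
    finally show ?thesis by (simp add: tensor_id_select[OF pq])
  qed
  then have "tensor_id (select m) n d k X = mat (d * k) (d * k)
      (\<lambda>(p,q). \<Sum>s\<in>rest m ` {..<n}. \<Sum>I<n * k. \<Sum>J<n * k. K s p I * X $$ (I,J) * cnj (K s q J))"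
    by (intro eq_matI) (auto simp: tensor_id_def)
  then show "psd (d * k) (tensor_id (select m) n d k X)"
    using psd_kraus[OF X, where k = "d * k" and S = "rest m ` {..<n}" and K = K] by (simp only:)
qed

text \<open>The test \<open>T\<close> on \<open>B\<close> and Bob's \<open>m\<close>-th register,
  tensored with the identity on his other registers; the indicator is that identity.\<close>

definition test_at :: "nat \<Rightarrow> nat \<Rightarrow> cmat \<Rightarrow> cmat" where
  "test_at dB m T = mat (dB * n) (dB * n) (\<lambda>(p,q). of_bool (rest m (p mod n) = rest m (q mod n)) *
     T $$ (p div n * d + D (p mod n) m, q div n * d + D (q mod n) m))"

lemma test_index_less:
  assumes "p < dB * n" "m < M"
  shows "p div n * d + D (p mod n) m < dB * d"
proof -
  have "p div n < dB" using assms(1) by (simp add: less_mult_imp_div_less)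
  moreover have "n > 0" using assms(1) by (cases "n = 0") auto
  ultimately show ?thesis
    using assms(2) digit_less[of "p mod n" m] by (intro mult_add_less) auto
qed

lemma psd_test_at:
  assumes "psd (dB * d) T" "m < M"
  shows "psd (dB * n) (test_at dB m T)"
  unfolding test_at_def using psd_pullback[OF assms(1), of "dB * n"
    "\<lambda>p. p div n * d + D (p mod n) m" "\<lambda>p. rest m (p mod n)"] test_index_less assms(2) by simp

text \<open>The channel index, the digit at \<open>m\<close> and the remaining digits determine the
  full index, so the identity embeds to the identity. It transfers the upper bound
  \<open>T \<le> 1\<close> to the embedded test.\<close>

lemma one_minus_test_at:
  assumes T: "T \<in> carrier_mat (dB * d) (dB * d)" and m: "m < M"
  shows "1\<^sub>m (dB * n) - test_at dB m T = test_at dB m (1\<^sub>m (dB * d) - T)"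
proof (rule eq_matI)
  fix p q assume "p < dim_row (test_at dB m (1\<^sub>m (dB * d) - T))"
    "q < dim_col (test_at dB m (1\<^sub>m (dB * d) - T))"
  then have pq: "p < dB * n" "q < dB * n" by (simp_all add: test_at_def)
  let ?\<pi> = "\<lambda>p. p div n * d + D (p mod n) m"
  have n0: "n > 0" using pq by (cases "n = 0") auto
  have \<pi>: "?\<pi> p < dB * d" "?\<pi> q < dB * d" using test_index_less[OF _ m] pq by auto
  have "p = q" if r: "rest m (p mod n) = rest m (q mod n)" and eq: "?\<pi> p = ?\<pi> q"
  proof -
    have D: "D (p mod n) m < d" "D (q mod n) m < d" using digit_less[OF _ m] n0 by auto
    have "p div n = ?\<pi> p div d" "q div n = ?\<pi> q div d"
      "D (p mod n) m = ?\<pi> p mod d" "D (q mod n) m = ?\<pi> q mod d" using D by auto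
    then have "p div n = q div n" "D (p mod n) m = D (q mod n) m" using eq by auto
    moreover have "p mod n = q mod n"
      using digits_inject[OF r] \<open>D (p mod n) m = D (q mod n) m\<close> n0 by simp
    ultimately show ?thesis by (metis div_mult_mod_eq)
  qed
  then show "(1\<^sub>m (dB * n) - test_at dB m T) $$ (p,q) = test_at dB m (1\<^sub>m (dB * d) - T) $$ (p,q)"
    using pq \<pi> T by (auto simp: test_at_def)
qed (simp_all add: test_at_def)

text \<open>Once \<open>b\<close> and \<open>b'\<close> are fixed, test and state are both products
  over positions, so the sum over Bob's strings factorises. The state carries swapped arguments
  because of the matrix product under the trace.\<close>

lemma mtrace_test_at:
  fixes \<rho> T :: cmat and \<sigma> :: "nat \<Rightarrow> nat \<Rightarrow> complex"
  assumes Y: "Y \<in> carrier_mat (dB * n) (dB * n)" and "m < M" "m' < M"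
    and Y_eq: "\<And>b e b' e'. b < dB \<Longrightarrow> e < n \<Longrightarrow> b' < dB \<Longrightarrow> e' < n \<Longrightarrow>
      Y $$ (b * n + e, b' * n + e') = \<rho> $$ (b * d + D e m, b' * d + D e' m) *
        (\<Prod>j\<in>{..<M} - {m}. \<sigma> (D e j) (D e' j))"
  shows "mtrace (test_at dB m' T * Y) = (\<Sum>b<dB. \<Sum>b'<dB. \<Prod>j<M. \<Sum>x<d. \<Sum>y<d.
    (if j = m' then T $$ (b * d + x, b' * d + y) else of_bool (x = y)) *
    (if j = m then \<rho> $$ (b' * d + y, b * d + x) else \<sigma> y x))"
proof -
  let ?f = "\<lambda>b b' j x y. (if j = m' then T $$ (b * d + x, b' * d + y) else of_bool (x = y)) *
    (if j = m then \<rho> $$ (b' * d + y, b * d + x) else \<sigma> y x)"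
  have C: "test_at dB m' T \<in> carrier_mat (dB * n) (dB * n)" by (simp add: test_at_def)
  have prod_if: "(\<Prod>j<M. if j = i then g j else 1) = g i" if "i < M" for i and g :: "nat \<Rightarrow> complex"
    using that by (simp add: prod.delta)
  have "mtrace (test_at dB m' T * Y) = (\<Sum>b<dB. \<Sum>e<n. \<Sum>b'<dB. \<Sum>e'<n.
      test_at dB m' T $$ (b * n + e, b' * n + e') * Y $$ (b' * n + e', b * n + e))"
    unfolding mtrace_mult[OF C Y] sum_lessThan_mult ..
  also have "\<dots> = (\<Sum>b<dB. \<Sum>b'<dB. \<Sum>e<n. \<Sum>e'<n.
      test_at dB m' T $$ (b * n + e, b' * n + e') * Y $$ (b' * n + e', b * n + e))"
    by (intro sum.cong refl sum.swap)
  also have "\<dots> = (\<Sum>b<dB. \<Sum>b'<dB. \<Sum>e<n. \<Sum>e'<n. \<Prod>j<M. ?f b b' j (D e j) (D e' j))"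
  proof (intro sum.cong refl)
    fix b b' e e' assume "b \<in> {..<dB}" "b' \<in> {..<dB}" "e \<in> {..<n}" "e' \<in> {..<n}"
    then have lt: "b < dB" "b' < dB" "e < n" "e' < n" by auto
    have "test_at dB m' T $$ (b * n + e, b' * n + e') =
        of_bool (rest m' e = rest m' e') * T $$ (b * d + D e m', b' * d + D e' m')"
    proof -
      have "(b * n + e) div n = b" "(b' * n + e') div n = b'"
        using lt div_mult_self3[of n b e] div_mult_self3[of n b' e'] by (cases "n = 0"; simp)+
      then show ?thesis
        using lt mult_add_less[of b dB e n] mult_add_less[of b' dB e' n] by (simp add: test_at_def)
    qed
    also have "\<dots> = (\<Prod>j<M. if j = m' then 1 else of_bool (D e j = D e' j)) *
        (\<Prod>j<M. if j = m' then T $$ (b * d + D e j, b' * d + D e' j) else 1)"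
      using lt \<open>m' < M\<close> by (simp add: rest_eq_prod prod_if)
    also have "\<dots> = (\<Prod>j<M. if j = m' then T $$ (b * d + D e j, b' * d + D e' j)
        else of_bool (D e j = D e' j))"
      unfolding prod.distrib[symmetric] by (intro prod.cong) auto
    finally have 1: "test_at dB m' T $$ (b * n + e, b' * n + e') = \<dots>" .
    have "Y $$ (b' * n + e', b * n + e) =
        (\<Prod>j<M. if j = m then \<rho> $$ (b' * d + D e' j, b * d + D e j) else \<sigma> (D e' j) (D e j))"
      using Y_eq[OF lt(2,4,1,3)] \<open>m < M\<close> by (subst prod.remove[of _ m]) auto
    then show "test_at dB m' T $$ (b * n + e, b' * n + e') * Y $$ (b' * n + e', b * n + e) =
        (\<Prod>j<M. ?f b b' j (D e j) (D e' j))"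
      unfolding 1 prod.distrib by simp
  qed
  also have "\<dots> = (\<Sum>b<dB. \<Sum>b'<dB. \<Prod>j<M. \<Sum>x<d. \<Sum>y<d. ?f b b' j x y)"
  proof (intro sum.cong refl)
    fix b b'
    show "(\<Sum>e<n. \<Sum>e'<n. \<Prod>j<M. ?f b b' j (D e j) (D e' j)) = (\<Prod>j<M. \<Sum>x<d. \<Sum>y<d. ?f b b' j x y)"
      by (rule sum_prod_digits2[of "?f b b'"])
  qed
  finally show ?thesis .
qed

end

lemma psd_tensor_id:
  assumes "channel dA dB N" "psd (dA * k) X"
  shows "psd (dB * k) (tensor_id N dA dB k X)"
  using assms by (auto simp: channel_def)

lemma mtrace_ptrace1:
  assumes "X \<in> carrier_mat (dX * dY) (dX * dY)"
  shows "mtrace (ptrace1 dX dY X) = mtrace X"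
proof -
  have "mtrace (ptrace1 dX dY X) = (\<Sum>i<dY. \<Sum>k<dX. X $$ (k * dY + i, k * dY + i))"
    by (simp add: mtrace_def ptrace1_def)
  also have "\<dots> = (\<Sum>k<dX. \<Sum>i<dY. X $$ (k * dY + i, k * dY + i))" by (rule sum.swap)
  finally show ?thesis using assms by (simp add: mtrace_def sum_lessThan_mult)
qed

text \<open>A channel commutes with tracing out the reference. This evaluates the register paired
  with the transmitted half when Bob tests a different one.\<close>

lemma tensor_id_ptrace2:
  assumes N: "channel dA dB N" and "b < dB" "b' < dB"
  shows "(\<Sum>x<k. tensor_id N dA dB k X $$ (b * k + x, b' * k + x)) = N (ptrace2 dA k X) $$ (b,b')"
proof -
  have "(\<Sum>x<k. tensor_id N dA dB k X $$ (b * k + x, b' * k + x)) =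
      (\<Sum>x<k. N (mat dA dA (\<lambda>ij. X $$ (fst ij * k + x, snd ij * k + x))) $$ (b,b'))"
    using assms by (intro sum.cong refl) (simp add: tensor_id_def mult_add_less case_prod_beta')
  also have "\<dots> = N (mat dA dA (\<lambda>ij. \<Sum>x<k. X $$ (fst ij * k + x, snd ij * k + x))) $$ (b,b')"
    using assms by (intro channel_sum[symmetric]) auto
  finally show ?thesis by (simp add: ptrace2_def case_prod_beta')
qed

section \<open>Channel outputs for the shared copies and their acceptance probabilities\<close>

context digits
begin

text \<open>The \<open>M\<close>-fold tensor power of the pure state with its factors regrouped: the
  quotient by \<open>n\<close> encodes all of Alice's halves, the remainder all of Bob's.\<close>

definition copies :: "complex vec \<Rightarrow> cmat" where
  "copies v = mat (n * n) (n * n) (\<lambda>(p,q).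
     (\<Prod>j<M. v $ (D (p div n) j * d + D (p mod n) j)) *
     cnj (\<Prod>j<M. v $ (D (q div n) j * d + D (q mod n) j)))"

lemma pure_state_copies:
  assumes v: "(\<Sum>i<d * d. (cmod (v $ i))\<^sup>2) = 1"
  shows "pure_state (n * n) (copies v)"
proof -
  define w where "w = (\<lambda>p. \<Prod>j<M. v $ (D (p div n) j * d + D (p mod n) j))"
  have "complex_of_real (\<Sum>p<n * n. (cmod (w p))\<^sup>2) =
      (\<Sum>e<n. \<Sum>e'<n. \<Prod>j<M. complex_of_real ((cmod (v $ (D e j * d + D e' j)))\<^sup>2))"
    unfolding sum_lessThan_mult of_real_sum
  proof (intro sum.cong refl)
    fix e e' assume "e' \<in> {..<n}"
    then have "(e * n + e') div n = e" "e' mod n = e'"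
      using div_mult_self3[of n e e'] by (cases "n = 0"; simp)+
    then show "complex_of_real ((cmod (w (e * n + e')))\<^sup>2) =
        (\<Prod>j<M. complex_of_real ((cmod (v $ (D e j * d + D e' j)))\<^sup>2))"
      by (simp add: w_def prod_norm[symmetric] prod_power_distrib)
  qed
  also have "\<dots> = (\<Prod>j<M. \<Sum>x<d. \<Sum>y<d. complex_of_real ((cmod (v $ (x * d + y)))\<^sup>2))"
    by (rule sum_prod_digits2)
  also have "(\<Sum>x<d. \<Sum>y<d. complex_of_real ((cmod (v $ (x * d + y)))\<^sup>2)) =
      complex_of_real (\<Sum>i<d * d. (cmod (v $ i))\<^sup>2)"
    by (simp add: sum_lessThan_mult)
  finally have "complex_of_real (\<Sum>p<n * n. (cmod (w p))\<^sup>2) = 1" using v by simp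
  then have "(\<Sum>p<n * n. (cmod (w p))\<^sup>2) = 1" by (simp only: of_real_eq_1_iff)
  then show ?thesis
    unfolding pure_state_def
    by (intro bexI[of _ "vec (n * n) w"] conjI) (auto simp: copies_def w_def)
qed

text \<open>Copy \<open>m\<close> survives whole, since its Alice index is pinned to
  \<open>a\<close> and \<open>a'\<close>; in every other copy the sum over Alice's index leaves
  Bob's marginal.\<close>

lemma tensor_id_select_copies:
  assumes \<psi>: "\<psi> = mat (d * d) (d * d) (\<lambda>(i,j). v $ i * cnj (v $ j))" and m: "m < M"
    and lt: "a < d" "a' < d" "e < n" "e' < n"
  shows "tensor_id (select m) n d n (copies v) $$ (a * n + e, a' * n + e') =
    (\<Prod>j\<in>{..<M} - {m}. ptrace1 d d \<psi> $$ (D e j, D e' j)) * \<psi> $$ (a * d + D e m, a' * d + D e' m)"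
proof -
  have div: "(i * n + e) div n = i" "(i * n + e') div n = i" for i
    using lt div_mult_self3[of n i e] div_mult_self3[of n i e'] by (cases "n = 0"; simp)+
  let ?g = "\<lambda>j x y. (if j = m then of_bool (x = a \<and> y = a') else of_bool (x = y)) *
    (v $ (x * d + D e j) * cnj (v $ (y * d + D e' j)))"
  have "tensor_id (select m) n d n (copies v) $$ (a * n + e, a' * n + e') = (\<Sum>i<n. \<Sum>i'<n.
      of_bool (D i m = a \<and> D i' m = a' \<and> rest m i = rest m i') *
      copies v $$ (i * n + e, i' * n + e'))"
    using lt by (simp add: tensor_id_select mult_add_less div)
  also have "\<dots> = (\<Sum>i<n. \<Sum>i'<n. \<Prod>j<M. ?g j (D i j) (D i' j))"
  proof (intro sum.cong refl)
    fix i i' assume "i \<in> {..<n}" "i' \<in> {..<n}"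
    then have i: "i < n" "i' < n" by auto
    have "of_bool (D i m = a \<and> D i' m = a' \<and> rest m i = rest m i') =
        (\<Prod>j<M. if j = m then of_bool (D i j = a \<and> D i' j = a') else 1) *
        (of_bool (rest m i = rest m i') :: complex)"
      using m by (simp add: prod.delta)
    also have "\<dots> = (\<Prod>j<M. if j = m then of_bool (D i j = a \<and> D i' j = a') else of_bool (D i j = D i' j))"
      unfolding rest_eq_prod[OF i] prod.distrib[symmetric] by (intro prod.cong) auto
    finally have 1: "of_bool (D i m = a \<and> D i' m = a' \<and> rest m i = rest m i') = \<dots>" .
    have "copies v $$ (i * n + e, i' * n + e') =
        (\<Prod>j<M. v $ (D i j * d + D e j) * cnj (v $ (D i' j * d + D e' j)))"
      using lt i by (simp add: copies_def mult_add_less div prod.distrib)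
    then show "of_bool (D i m = a \<and> D i' m = a' \<and> rest m i = rest m i') *
        copies v $$ (i * n + e, i' * n + e') = (\<Prod>j<M. ?g j (D i j) (D i' j))"
      unfolding 1 prod.distrib by simp
  qed
  also have "\<dots> = (\<Prod>j<M. \<Sum>x<d. \<Sum>y<d. ?g j x y)" by (rule sum_prod_digits2)
  also have "\<dots> = (\<Sum>x<d. \<Sum>y<d. ?g m x y) * (\<Prod>j\<in>{..<M} - {m}. \<Sum>x<d. \<Sum>y<d. ?g j x y)"
    using m by (intro prod.remove) auto
  also have "(\<Sum>x<d. \<Sum>y<d. ?g m x y) = \<psi> $$ (a * d + D e m, a' * d + D e' m)"
  proof -
    have "(\<Sum>x<d. \<Sum>y<d. ?g m x y) = (\<Sum>x<d. of_bool (x = a) * (\<Sum>y<d. of_bool (y = a') *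
        (v $ (x * d + D e m) * cnj (v $ (y * d + D e' m)))))"
      unfolding sum_distrib_left by (intro sum.cong refl) auto
    then show ?thesis
      using lt digit_less[OF lt(3) m] digit_less[OF lt(4) m]
      by (simp add: sum_of_bool_eq \<psi> mult_add_less)
  qed
  also have "(\<Prod>j\<in>{..<M} - {m}. \<Sum>x<d. \<Sum>y<d. ?g j x y) =
      (\<Prod>j\<in>{..<M} - {m}. ptrace1 d d \<psi> $$ (D e j, D e' j))"
  proof (intro prod.cong refl)
    fix j assume j: "j \<in> {..<M} - {m}"
    then have De: "D e j < d" "D e' j < d" using digit_less lt by auto
    have "(\<Sum>x<d. \<Sum>y<d. ?g j x y) = (\<Sum>x<d. \<Sum>y<d. of_bool (y = x) *
        (v $ (x * d + D e j) * cnj (v $ (y * d + D e' j))))"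
      using j by (intro sum.cong refl) auto
    also have "\<dots> = (\<Sum>x<d. v $ (x * d + D e j) * cnj (v $ (x * d + D e' j)))"
      by (intro sum.cong refl) (simp add: sum_of_bool_eq)
    also have "\<dots> = ptrace1 d d \<psi> $$ (D e j, D e' j)"
      using De by (simp add: ptrace1_def \<psi> mult_add_less)
    finally show "(\<Sum>x<d. \<Sum>y<d. ?g j x y) = ptrace1 d d \<psi> $$ (D e j, D e' j)" .
  qed
  finally show ?thesis by (simp only: mult.commute)
qed

lemma channel_output_copies:
  assumes N: "channel d dB N"
    and \<psi>: "\<psi> = mat (d * d) (d * d) (\<lambda>(i,j). v $ i * cnj (v $ j))" and m: "m < M"
    and lt: "b < dB" "e < n" "b' < dB" "e' < n"
  shows "tensor_id N d dB n (tensor_id (select m) n d n (copies v)) $$ (b * n + e, b' * n + e') =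
    tensor_id N d dB d \<psi> $$ (b * d + D e m, b' * d + D e' m) *
    (\<Prod>j\<in>{..<M} - {m}. ptrace1 d d \<psi> $$ (D e j, D e' j))"
proof -
  define c where "c = (\<Prod>j\<in>{..<M} - {m}. ptrace1 d d \<psi> $$ (D e j, D e' j))"
  define Z where "Z = mat d d (\<lambda>(i,j). \<psi> $$ (i * d + D e m, j * d + D e' m))"
  have Z: "Z \<in> carrier_mat d d" by (simp add: Z_def)
  have div: "(b * n + e) div n = b" "(b' * n + e') div n = b'"
    using lt div_mult_self3[of n b e] div_mult_self3[of n b' e'] by (cases "n = 0"; simp)+
  have div': "(b * d + D e m) div d = b" "(b' * d + D e' m) div d = b'"
    and De: "D e m < d" "D e' m < d"
    using digit_less[OF lt(2) m] digit_less[OF lt(4) m] by auto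
  have "tensor_id N d dB n (tensor_id (select m) n d n (copies v)) $$ (b * n + e, b' * n + e') =
      N (mat d d (\<lambda>(i,j). tensor_id (select m) n d n (copies v) $$ (i * n + e, j * n + e'))) $$ (b,b')"
    using lt by (simp add: tensor_id_def[of N] mult_add_less div)
  also have "mat d d (\<lambda>(i,j). tensor_id (select m) n d n (copies v) $$ (i * n + e, j * n + e')) = c \<cdot>\<^sub>m Z"
    by (intro eq_matI) (auto simp: Z_def c_def tensor_id_select_copies[OF \<psi> m] lt)
  also have "N (c \<cdot>\<^sub>m Z) $$ (b,b') = c * N Z $$ (b,b')"
    unfolding channel_smult[OF N Z] using channelD(1)[OF N Z] lt by simp
  also have "N Z $$ (b,b') = tensor_id N d dB d \<psi> $$ (b * d + D e m, b' * d + D e' m)"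
    using lt De by (simp add: tensor_id_def mult_add_less div' Z_def)
  finally show ?thesis unfolding c_def by (simp add: mult.commute)
qed

text \<open>Factors away from \<open>m\<close> and \<open>m'\<close> are traces of a marginal and
  equal 1. If \<open>m' = m\<close>, one factor carries both test and output. Otherwise factor
  \<open>m'\<close> pairs the test with Bob's marginal, factor \<open>m\<close> is an entry of the
  channel output on Alice's marginal, and together they are the product state.\<close>

lemma mtrace_test_at_copies:
  assumes N: "channel d dB N"
    and \<psi>: "\<psi> = mat (d * d) (d * d) (\<lambda>(i,j). v $ i * cnj (v $ j))" "mtrace \<psi> = 1"
    and m: "m < M" "m' < M" and T: "T \<in> carrier_mat (dB * d) (dB * d)"
  shows "mtrace (test_at dB m' T * tensor_id N d dB n (tensor_id (select m) n d n (copies v))) =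
    mtrace (T * (if m' = m then tensor_id N d dB d \<psi> else kron (N (ptrace2 d d \<psi>)) (ptrace1 d d \<psi>)))"
    (is "mtrace (_ * ?Y) = _")
proof -
  let ?\<rho> = "tensor_id N d dB d \<psi>" and ?\<sigma> = "\<lambda>i j. ptrace1 d d \<psi> $$ (i,j)"
  let ?f = "\<lambda>b b' j x y. (if j = m' then T $$ (b * d + x, b' * d + y) else of_bool (x = y)) *
    (if j = m then ?\<rho> $$ (b' * d + y, b * d + x) else ?\<sigma> y x)"
  have Y: "?Y \<in> carrier_mat (dB * n) (dB * n)" by (simp add: tensor_id_def[of N])
  have tr: "mtrace (test_at dB m' T * ?Y) = (\<Sum>b<dB. \<Sum>b'<dB. \<Prod>j<M. \<Sum>x<d. \<Sum>y<d. ?f b b' j x y)"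
    by (rule mtrace_test_at[OF Y m]) (rule channel_output_copies[OF N \<psi>(1) m(1)])
  have "\<psi> \<in> carrier_mat (d * d) (d * d)" by (simp add: \<psi>(1))
  then have "(\<Sum>x<d. ?\<sigma> x x) = 1"
    using mtrace_ptrace1[of \<psi> d d] \<psi>(2) by (simp add: mtrace_def[of "ptrace1 d d \<psi>"]) (simp add: ptrace1_def)
  have diag: "(\<Sum>x<d. \<Sum>y<d. of_bool (x = y) * h x y) = (\<Sum>x<d. h x x)" for h :: "nat \<Rightarrow> nat \<Rightarrow> complex"
    by (intro sum.cong refl) (simp add: sum_of_bool_eq eq_commute[of _ "_ :: nat"])
  show ?thesis
  proof (cases "m' = m")
    case True
    have "(\<Prod>j<M. \<Sum>x<d. \<Sum>y<d. ?f b b' j x y) =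
        (\<Sum>x<d. \<Sum>y<d. T $$ (b * d + x, b' * d + y) * ?\<rho> $$ (b' * d + y, b * d + x))" for b b'
    proof -
      have "(\<Prod>j<M. \<Sum>x<d. \<Sum>y<d. ?f b b' j x y) = (\<Prod>j<M. if j = m then
          (\<Sum>x<d. \<Sum>y<d. T $$ (b * d + x, b' * d + y) * ?\<rho> $$ (b' * d + y, b * d + x)) else 1)"
        using True diag \<open>(\<Sum>x<d. ?\<sigma> x x) = 1\<close> by (intro prod.cong refl) auto
      then show ?thesis using m by (simp add: prod.delta)
    qed
    moreover have "?\<rho> \<in> carrier_mat (dB * d) (dB * d)" by (simp add: tensor_id_def)
    ultimately show ?thesis
      unfolding tr using True
      by (simp add: mtrace_mult[OF T] sum_lessThan_mult) (intro sum.cong refl sum.swap)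
  next
    case False
    let ?K = "kron (N (ptrace2 d d \<psi>)) (ptrace1 d d \<psi>)"
    have "ptrace2 d d \<psi> \<in> carrier_mat d d" by (simp add: ptrace2_def)
    then have NA: "N (ptrace2 d d \<psi>) \<in> carrier_mat dB dB" by (rule channelD(1)[OF N])
    have P1: "ptrace1 d d \<psi> \<in> carrier_mat d d" by (simp add: ptrace1_def)
    have K: "?K \<in> carrier_mat (dB * d) (dB * d)" using NA P1 by (auto simp: kron_def)
    have "(\<Prod>j<M. \<Sum>x<d. \<Sum>y<d. ?f b b' j x y) =
        (\<Sum>x<d. \<Sum>y<d. T $$ (b * d + x, b' * d + y) * ?K $$ (b' * d + y, b * d + x))"
      if "b < dB" "b' < dB" for b b'
    proof -
      let ?A = "\<Sum>x<d. \<Sum>y<d. T $$ (b * d + x, b' * d + y) * ?\<sigma> y x"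
      let ?B = "N (ptrace2 d d \<psi>) $$ (b',b)"
      have "(\<Prod>j<M. \<Sum>x<d. \<Sum>y<d. ?f b b' j x y) =
          (\<Prod>j<M. (if j = m' then ?A else 1) * (if j = m then ?B else 1))"
        using False diag \<open>(\<Sum>x<d. ?\<sigma> x x) = 1\<close> tensor_id_ptrace2[OF N that(2,1), of d \<psi>]
        by (intro prod.cong refl) auto
      also have "\<dots> = ?A * ?B" using m by (simp add: prod.distrib prod.delta)
      also have "\<dots> = (\<Sum>x<d. \<Sum>y<d. T $$ (b * d + x, b' * d + y) * ?K $$ (b' * d + y, b * d + x))"
        unfolding sum_distrib_right
      proof (intro sum.cong refl)
        fix x y assume "x \<in> {..<d}" "y \<in> {..<d}"
        then show "T $$ (b * d + x, b' * d + y) * ?\<sigma> y x * ?B =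
            T $$ (b * d + x, b' * d + y) * ?K $$ (b' * d + y, b * d + x)"
          using that NA P1 by (auto simp: kron_def mult_add_less)
      qed
      finally show ?thesis .
    qed
    then show ?thesis
      unfolding tr using False
      by (simp add: mtrace_mult[OF T K] sum_lessThan_mult) (intro sum.cong refl sum.swap)
  qed
qed

end

section \<open>From the entropy bound to the error bound\<close>

lemma DH_test:
  assumes "M \<ge> 1" "0 < \<epsilon>" "0 < \<delta>"
    and R: "ereal (log 2 (real M)) \<le> DH \<epsilon> n \<rho> \<sigma> - ereal (2 * log 2 (1/\<delta>))"
  obtains T where "psd n T" "psd n (1\<^sub>m n - T)" "1 - \<epsilon>\<^sup>2 \<le> Re (mtrace (T * \<rho>))"
    "real M * Re (mtrace (T * \<sigma>)) \<le> \<delta>\<^sup>2 + \<epsilon> * \<delta>"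
proof -
  \<comment> \<open>The factor lost by taking a test strictly within reach of the supremum, chosen
    so that \<open>\<delta>\<^sup>2 * K = \<delta>\<^sup>2 + \<epsilon> * \<delta>\<close>.\<close>
  define K where "K = 1 + \<epsilon> / \<delta>"
  have K: "K > 1" using assms by (simp add: K_def)
  then have "log 2 K > 0" by simp
  then have "ereal (log 2 (real M) + 2 * log 2 (1/\<delta>) - log 2 K) < DH \<epsilon> n \<rho> \<sigma>"
    using R by (cases "DH \<epsilon> n \<rho> \<sigma>") auto
  then obtain T where T: "psd n T" "psd n (1\<^sub>m n - T)" "1 - \<epsilon>\<^sup>2 \<le> Re (mtrace (T * \<rho>))"
    and less: "ereal (log 2 (real M) + 2 * log 2 (1/\<delta>) - log 2 K) <
      (if Re (mtrace (T * \<sigma>)) = 0 then \<infinity> else ereal (log 2 (1 / Re (mtrace (T * \<sigma>)))))"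
    unfolding DH_def less_Sup_iff by blast
  define t where "t = Re (mtrace (T * \<sigma>))"
  have "real M * t \<le> \<delta>\<^sup>2 + \<epsilon> * \<delta>"
  proof (cases "t > 0")
    case True
    have "log 2 (real M) + 2 * log 2 (1/\<delta>) - log 2 K = log 2 (real M * (1/\<delta>)\<^sup>2 / K)"
      using assms(1-3) K by (simp add: log_mult log_divide log_nat_power)
    then have "log 2 (real M * (1/\<delta>)\<^sup>2 / K) < log 2 (1 / t)"
      using less True unfolding t_def by simp
    then have "real M * (1/\<delta>)\<^sup>2 / K < 1 / t"
      using assms(1-3) K True by (subst (asm) log_less_cancel_iff) auto
    then have "real M * t < \<delta>\<^sup>2 * K"
      using assms(2,3) K True by (simp add: field_simps power2_eq_square)
    then show ?thesis
      using assms(3) by (simp add: K_def algebra_simps power2_eq_square)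
  next
    case False
    \<comment> \<open>This covers the infinite branch of \<open>DH\<close>, where
      \<open>t = 0\<close>; for nonpositive \<open>t\<close> the bound is immediate.\<close>
    then have "real M * t \<le> 0" by (simp add: mult_nonneg_nonpos)
    also have "0 \<le> \<delta>\<^sup>2 + \<epsilon> * \<delta>" using assms by simp
    finally show ?thesis .
  qed
  then show ?thesis using that T by (simp add: t_def)
qed

theorem theorem1:
  fixes dA dB M :: nat and N :: "cmat \<Rightarrow> cmat" and \<epsilon> \<delta> :: real and \<psi> :: cmat
  assumes "dA > 0" "dB > 0"
    and "channel dA dB N"
    and "0 < \<epsilon>" "\<epsilon> < 1" "0 < \<delta>" "\<delta> < 1"
    and "M \<ge> 1"
    and "pure_state (dA*dA) \<psi>"
    and "ereal (log 2 (real M)) \<le>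
           DH \<epsilon> (dB*dA) (tensor_id N dA dB dA \<psi>) (kron (N (ptrace2 dA dA \<psi>)) (ptrace1 dA dA \<psi>))
           - ereal (2 * log 2 (1/\<delta>))"
  shows "EA_code dA dB N M (2*\<epsilon> + 2*\<delta>)"
proof -
  note N = assms(3)
  let ?\<rho> = "tensor_id N dA dB dA \<psi>" and ?\<sigma> = "kron (N (ptrace2 dA dA \<psi>)) (ptrace1 dA dA \<psi>)"
  obtain T where T: "psd (dB * dA) T" "psd (dB * dA) (1\<^sub>m (dB * dA) - T)"
    and good: "1 - \<epsilon>\<^sup>2 \<le> Re (mtrace (T * ?\<rho>))"
    and bad: "real M * Re (mtrace (T * ?\<sigma>)) \<le> \<delta>\<^sup>2 + \<epsilon> * \<delta>"
    using DH_test[OF assms(8,4,6,10)] .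
  have cT: "T \<in> carrier_mat (dB * dA) (dB * dA)" using T(1) by (simp add: psd_def)
  obtain v where v: "(\<Sum>i<dA * dA. (cmod (v $ i))\<^sup>2) = 1"
    and \<psi>: "\<psi> = mat (dA * dA) (dA * dA) (\<lambda>(i,j). v $ i * cnj (v $ j))"
    using assms(9) unfolding pure_state_def by blast
  have tr\<psi>: "mtrace \<psi> = 1" using mtrace_pure_state[OF assms(9)] .
  obtain D where "bij_betw D {..<dA ^ M} (PiE {..<M} (\<lambda>_. {..<dA}))"
    using ex_digits by blast
  then interpret digits dA M D by unfold_locales
  define out where "out = (\<lambda>m. tensor_id N dA dB n (tensor_id (select m) n dA n (copies v)))"
  have pure: "pure_state (n * n) (copies v)" by (rule pure_state_copies[OF v])
  have psd_out: "psd (dB * n) (out m)" and tr_out: "mtrace (out m) = 1" if "m < M" for m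
  proof -
    note sel = channel_select[OF that]
    show "psd (dB * n) (out m)"
      unfolding out_def by (intro psd_tensor_id[OF N] psd_tensor_id[OF sel] psd_pure_state pure)
    have "copies v \<in> carrier_mat (n * n) (n * n)" by (simp add: copies_def)
    moreover have "tensor_id (select m) n dA n (copies v) \<in> carrier_mat (dA * n) (dA * n)"
      by (simp add: tensor_id_def)
    ultimately show "mtrace (out m) = 1"
      unfolding out_def using mtrace_tensor_id[OF N] mtrace_tensor_id[OF sel] mtrace_pure_state[OF pure]
      by simp
  qed
  have S: "psd (dB * n) (test_at dB m T)" "psd (dB * n) (1\<^sub>m (dB * n) - test_at dB m T)" if "m < M" for m
    using psd_test_at[OF T(1) that] psd_test_at[OF T(2) that] one_minus_test_at[OF cT that] by simp_all
  have "\<epsilon> * \<delta> > 0" using assms by simp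
  then obtain \<Lambda> where povm: "povm (dB * n) M \<Lambda>"
    and err: "\<And>m \<rho>. m < M \<Longrightarrow> psd (dB * n) \<rho> \<Longrightarrow>
       Re (\<Sum>m'\<in>{..<M} - {m}. mtrace (\<Lambda> m' * \<rho>)) \<le>
       2 * (Re (mtrace \<rho>) - Re (mtrace (test_at dB m T * \<rho>))) +
       4 * ((\<Sum>m'\<in>{..<M} - {m}. Re (mtrace (test_at dB m' T * \<rho>))) + \<epsilon> * \<delta> * Re (mtrace \<rho>))"
    using hayashi_nagaoka_povm[where S = "\<lambda>m. test_at dB m T", OF assms(8) S] by blast
  have "Re (\<Sum>m'\<in>{..<M} - {m}. mtrace (\<Lambda> m' * out m)) \<le> (2*\<epsilon> + 2*\<delta>)\<^sup>2" if m: "m < M" for m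
  proof -
    let ?t = "Re (mtrace (T * ?\<sigma>))"
    have same: "mtrace (test_at dB m T * out m) = mtrace (T * ?\<rho>)"
      unfolding out_def using mtrace_test_at_copies[OF N \<psi> tr\<psi> m m cT] by simp
    have "(\<Sum>m'\<in>{..<M} - {m}. Re (mtrace (test_at dB m' T * out m))) = (\<Sum>m'\<in>{..<M} - {m}. ?t)"
      unfolding out_def using mtrace_test_at_copies[OF N \<psi> tr\<psi> m _ cT]
      by (intro sum.cong refl) auto
    also have "\<dots> = (real M - 1) * ?t" using m by (simp add: of_nat_diff)
    \<comment> \<open>Replacing \<open>M - 1\<close> by \<open>M\<close> requires a nonnegative
      trace; splitting on its sign stands in for a proof that the product state is positive.\<close>
    also have "\<dots> \<le> \<delta>\<^sup>2 + \<epsilon> * \<delta>"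
    proof (cases "?t \<ge> 0")
      case True
      then show ?thesis using bad by (simp add: algebra_simps)
    next
      case False
      then have "(real M - 1) * ?t \<le> 0" using assms(8) by (intro mult_nonneg_nonpos) auto
      also have "0 \<le> \<delta>\<^sup>2 + \<epsilon> * \<delta>" using assms by simp
      finally show ?thesis .
    qed
    finally have "Re (\<Sum>m'\<in>{..<M} - {m}. mtrace (\<Lambda> m' * out m)) \<le>
        2 * (1 - Re (mtrace (T * ?\<rho>))) + 4 * (\<delta>\<^sup>2 + \<epsilon> * \<delta> + \<epsilon> * \<delta>)"
      using err[OF m psd_out[OF m]] unfolding same tr_out[OF m] by (simp add: mult.commute)
    also have "\<dots> \<le> 2 * \<epsilon>\<^sup>2 + 4 * (\<delta>\<^sup>2 + \<epsilon> * \<delta> + \<epsilon> * \<delta>)" using good by simp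
    also have "\<dots> \<le> (2*\<epsilon> + 2*\<delta>)\<^sup>2" by (simp add: power2_eq_square algebra_simps)
    finally show ?thesis .
  qed
  moreover have "n > 0" using assms(1) by simp
  ultimately show ?thesis
    unfolding EA_code_def Let_def using pure povm channel_select
    by (intro exI[of _ n] exI[of _ "copies v"] exI[of _ select] exI[of _ \<Lambda>]) (auto simp: out_def)
qed

end
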